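(* Let $\mathbf{T} = (T, \mu, \mathcal{A}) \in \tilde{\mathcal{T}}$ and assume that $T$ is totally ergodic (i.e. $T^k$ is $\mu$-ergodic for all $k\in\mathbb{N}$). Let $x \in [0,1]$. The following statements are equivalent. (i) $x$ is $\mathbf{T}$-normal. (ii) $(T^n x)$ is equidistributed in $[0,1]$ with respect to $\mu$, that is, for any continuous function $f:[0,1] \rightarrow \mathbb{R}$, $\lim_{N \rightarrow \infty} \frac{1}{N} \sum_{n=0}^{N-1} f(T^n x) = \int f \, d\mu$. (iii) For any $m \geq 2$, $x$ is $\mathbf{T}_m$-normal. (iv) $T^k x$ is simply $\mathbf{T}_m$-normal for all $k \geq 0$ and $m \geq 1$. (v) $x$ is simply $\mathbf{T}_m$-normal for all $m \geq 1$. (vi) There exists a sequence $(m_l)_{l \in \mathbb{N}}$ of positive integers with $m_1 < m_2 < \cdots$ such that $x$ is simply $\mathbf{T}_{m_l}$-normal for any $l \in \mathbb{N}$.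
   Context: $\lambda$ is Lebesgue measure on $[0,1]$, $\mathcal{B}$ the Borel $\sigma$-algebra of $[0,1]$. Class $\tilde{\mathcal{T}}$: the triples $(T,\mu,\mathcal{A})$ where $\mu$ is a probability measure on $\mathcal{B}$ equivalent to $\lambda$ (mutually absolutely continuous); $T:[0,1]\to[0,1]$ is a measurable, $\mu$-preserving, $\mu$-ergodic map; $\mathcal{A}$ is a finite or countable partition of $[0,1]$ (up to a $\lambda$-null set) into intervals (open, closed, or half open) with nonempty and disjoint interiors such that for every $I\in\mathcal{A}$ the map $T|_{\mathrm{int}(I)}$ is continuous and strictly monotone; and $\mathcal{B}=\bigvee_{j=0}^\infty T^{-j}\sigma(\mathcal{A})\bmod\lambda$, where $\sigma(\mathcal{A})$ is the $\sigma$-algebra generated by $\mathcal{A}$. Write $\mathcal{A}=\{I_j:j\in D\}$ with $D$ a finite or countably infinite index set. The F-representation of $x$ is the sequence $(r_n(x))_{n\ge1}$ with $r_n=r_n(x)=j$ if $T^{n-1}x\in I_j$. For $S=(v_1,\dots,v_k)\in D^k$ the cylinder set is $C_{\mathbf{T}}(S)=[v_1,\dots,v_k]_{\mathbf{T}}=\{y\in[0,1):r_1(y)=v_1,\dots,r_k(y)=v_k\}$. $x$ is simply $\mathbf{T}$-normal if for every $v\in D$, $\lim_{N\to\infty}\frac1N\#\{1\le n\le N:r_n=v\}=\mu([v]_{\mathbf{T}})$. $x$ is $\mathbf{T}$-normal if for every $k\in\mathbb{N}$ and every $S=(v_1,\dots,v_k)\in D^k$, $\lim_{N\to\infty}\frac1N\#\{1\le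 n\le N:r_n=v_1,\dots,r_{n+k-1}=v_k\}=\mu(C_{\mathbf{T}}(S))$. For $m\in\mathbb{N}$, $\mathbf{T}_m=(T^m,\mu,\mathcal{A}^m)$, where $\mathcal{A}^m=\bigvee_{j=0}^{m-1}T^{-j}\mathcal{A}$ is the partition into cylinders $C_{\mathbf T}(S)$, $S\in D^m$; $\mathbf{T}_m$-normality and simple $\mathbf{T}_m$-normality are the notions of $\mathbf{T}$-normality and simple $\mathbf{T}$-normality with the triple $\mathbf{T}=(T,\mu,\mathcal{A})$ replaced by the triple $\mathbf{T}_m=(T^m,\mu,\mathcal{A}^m)$. Explicitly, $x$ is $\mathbf{T}_m$-normal if for every $p\in\mathbb{N}$ and every $S=(v_1,\dots,v_{mp})\in D^{mp}$, $\lim_{N\to\infty}\frac1N\#\{1\le n\le N:r_{m(n-1)+1}=v_1,\dots,r_{m(n-1)+mp}=v_{mp}\}=\mu(C_{\mathbf{T}}(S))$, and $x$ is simply $\mathbf{T}_m$-normal if for every $S=(v_1,\dots,v_m)\in D^m$, $\lim_{N\to\infty}\frac1N\#\{1\le n\le N:r_{m(n-1)+1}=v_1,\dots,r_{mn}=v_m\}=\mu(C_{\mathbf{T}}(S))$. *)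

theory Defs
  imports "HOL-Analysis.Analysis" "HOL-Probability.Probability"
begin

text \<open>
  A triple of the class is given by a map \<open>T\<close>, a measure \<open>\<mu>\<close> on the Borel sets of \<open>[0,1]\<close> and
  an indexed family \<open>I\<close> of intervals with index set \<open>D\<close>. The values of \<open>T\<close> outside \<open>[0,1]\<close> are
  irrelevant.
\<close>

definition unit_borel :: "real measure" where
  "unit_borel = restrict_space borel {0..1}"

definition unit_lebesgue :: "real measure" where
  "unit_lebesgue = restrict_space lborel {0..1}"

definition ergodic_map :: "'a measure \<Rightarrow> ('a \<Rightarrow> 'a) \<Rightarrow> bool" where
  "ergodic_map \<mu> T \<longleftrightarrow>
     (\<forall>A\<in>sets \<mu>. T -` A \<inter> space \<mu> = A \<longrightarrow> measure \<mu> A = 0 \<or> measure \<mu> A = 1)"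

definition totally_ergodic_map :: "'a measure \<Rightarrow> ('a \<Rightarrow> 'a) \<Rightarrow> bool" where
  "totally_ergodic_map \<mu> T \<longleftrightarrow> (\<forall>k\<ge>1. ergodic_map \<mu> (T ^^ k))"

text \<open>
  Only the interiors are required to be disjoint, so two intervals may share an endpoint, and a
  null set may be left uncovered. The interior is the one in the real line, which for an interval
  contained in \<open>[0,1]\<close> is the open interval with the same endpoints.
\<close>

definition interval_partition :: "'d set \<Rightarrow> ('d \<Rightarrow> real set) \<Rightarrow> bool" where
  "interval_partition D I \<longleftrightarrow>
     countable D \<and>
     (\<forall>j\<in>D. is_interval (I j) \<and> I j \<subseteq> {0..1} \<and> interior (I j) \<noteq> {}) \<and>
     (\<forall>i\<in>D. \<forall>j\<in>D. i \<noteq> j \<longrightarrow> interior (I i) \<inter> interior (I j) = {}) \<and>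
     {0..1} - (\<Union>j\<in>D. I j) \<in> null_sets unit_lebesgue"

text \<open>The join of the \<sigma>-algebras \<open>T\<^sup>-\<^sup>n \<sigma>(\<A>)\<close>, \<open>n \<ge> 0\<close>.\<close>

definition generated_sigma ::
    "(real \<Rightarrow> real) \<Rightarrow> 'd set \<Rightarrow> ('d \<Rightarrow> real set) \<Rightarrow> real set set" where
  "generated_sigma T D I =
     sigma_sets {0..1}
       (\<Union>n. {(T ^^ n) -` A \<inter> {0..1} | A. A \<in> sigma_sets {0..1} (I ` D)})"

definition equal_mod :: "'a measure \<Rightarrow> 'a set set \<Rightarrow> 'a set set \<Rightarrow> bool" where
  "equal_mod M \<F> \<G> \<longleftrightarrow>
     (\<forall>A\<in>\<F>. \<exists>B\<in>\<G>. sym_diff A B \<in> null_sets M) \<and>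
     (\<forall>B\<in>\<G>. \<exists>A\<in>\<F>. sym_diff A B \<in> null_sets M)"

definition F_system ::
    "(real \<Rightarrow> real) \<Rightarrow> real measure \<Rightarrow> 'd set \<Rightarrow> ('d \<Rightarrow> real set) \<Rightarrow> bool" where
  "F_system T \<mu> D I \<longleftrightarrow>
     prob_space \<mu> \<and> sets \<mu> = sets unit_borel \<and>
     absolutely_continuous unit_lebesgue \<mu> \<and> absolutely_continuous \<mu> unit_lebesgue \<and>
     T \<in> measurable \<mu> \<mu> \<and> distr \<mu> \<mu> T = \<mu> \<and> ergodic_map \<mu> T \<and>
     interval_partition D I \<and>
     (\<forall>j\<in>D. continuous_on (interior (I j)) T \<and>
        (strict_mono_on (interior (I j)) T \<or> strict_antimono_on (interior (I j)) T)) \<and>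
     equal_mod unit_lebesgue (sets unit_borel) (generated_sigma T D I)"

text \<open>
  \<open>has_digit T I x n j\<close> says that \<open>r\<^sub>n(x) = j\<close>, for \<open>n \<ge> 1\<close>. It is a relation and not a function
  because \<open>T\<^bsup>n-1\<^esup> x\<close> may lie in no interval of the partition, or be a common endpoint of two of
  them; if the intervals are pairwise disjoint, then there is at most one such \<open>j\<close>.
\<close>

definition has_digit ::
    "(real \<Rightarrow> real) \<Rightarrow> ('d \<Rightarrow> real set) \<Rightarrow> real \<Rightarrow> nat \<Rightarrow> 'd \<Rightarrow> bool" where
  "has_digit T I x n j \<longleftrightarrow> (T ^^ (n - 1)) x \<in> I j"

text \<open>
  \<open>has_block T I x n S\<close> says that \<open>r\<^sub>n = v\<^sub>1, \<dots>, r\<^bsub>n+k-1\<^esub> = v\<^sub>k\<close> for \<open>S = [v\<^sub>1, \<dots>, v\<^sub>k]\<close>.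
\<close>

definition has_block ::
    "(real \<Rightarrow> real) \<Rightarrow> ('d \<Rightarrow> real set) \<Rightarrow> real \<Rightarrow> nat \<Rightarrow> 'd list \<Rightarrow> bool" where
  "has_block T I x n S \<longleftrightarrow> (\<forall>i<length S. has_digit T I x (n + i) (S ! i))"

definition cylinder_set :: "(real \<Rightarrow> real) \<Rightarrow> ('d \<Rightarrow> real set) \<Rightarrow> 'd list \<Rightarrow> real set" where
  "cylinder_set T I S = {y \<in> {0..<1}. has_block T I y 1 S}"

definition words :: "'d set \<Rightarrow> nat \<Rightarrow> 'd list set" where
  "words D k = {S. set S \<subseteq> D \<and> length S = k}"

definition normal_point ::
    "(real \<Rightarrow> real) \<Rightarrow> real measure \<Rightarrow> 'd set \<Rightarrow> ('d \<Rightarrow> real set) \<Rightarrow> real \<Rightarrow> bool" where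
  "normal_point T \<mu> D I x \<longleftrightarrow>
     (\<forall>k\<ge>1. \<forall>S\<in>words D k.
        (\<lambda>N. real (card {n\<in>{1..N}. has_block T I x n S}) / real N)
          \<longlonglongrightarrow> measure \<mu> (cylinder_set T I S))"

text \<open>
  Normality and simple normality with respect to \<open>(T\<^sup>m, \<mu>, \<A>\<^sup>m)\<close>: the digits of \<open>x\<close> are read in
  consecutive blocks of length \<open>m\<close>, and the \<open>n\<close>-th block begins at position \<open>m(n-1)+1\<close>.
\<close>

definition power_normal_point ::
    "(real \<Rightarrow> real) \<Rightarrow> real measure \<Rightarrow> 'd set \<Rightarrow> ('d \<Rightarrow> real set) \<Rightarrow> nat \<Rightarrow> real \<Rightarrow> bool" where
  "power_normal_point T \<mu> D I m x \<longleftrightarrow>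
     (\<forall>p\<ge>1. \<forall>S\<in>words D (m * p).
        (\<lambda>N. real (card {n\<in>{1..N}. has_block T I x (m * (n - 1) + 1) S}) / real N)
          \<longlonglongrightarrow> measure \<mu> (cylinder_set T I S))"

definition simply_power_normal_point ::
    "(real \<Rightarrow> real) \<Rightarrow> real measure \<Rightarrow> 'd set \<Rightarrow> ('d \<Rightarrow> real set) \<Rightarrow> nat \<Rightarrow> real \<Rightarrow> bool" where
  "simply_power_normal_point T \<mu> D I m x \<longleftrightarrow>
     (\<forall>S\<in>words D m.
        (\<lambda>N. real (card {n\<in>{1..N}. has_block T I x (m * (n - 1) + 1) S}) / real N)
          \<longlonglongrightarrow> measure \<mu> (cylinder_set T I S))"

definition equidistributed_orbit :: "(real \<Rightarrow> real) \<Rightarrow> real measure \<Rightarrow> real \<Rightarrow> bool" where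
  "equidistributed_orbit T \<mu> x \<longleftrightarrow>
     (\<forall>f :: real \<Rightarrow> real. continuous_on {0..1} f \<longrightarrow>
        (\<lambda>N. (\<Sum>n<N. f ((T ^^ n) x)) / real N) \<longlonglongrightarrow> (\<integral>y. f y \<partial>\<mu>))"

end

theory Submission
  imports Defs "HOL-Real_Asymp.Real_Asymp"
begin

text \<open>
  Up to a null set, a cylinder agrees with the cell of the points whose itinerary runs
  through the interiors of the given intervals. By monotonicity of the branches cells are
  intervals, and since the itineraries generate the Borel sets, most cells of high rank
  are short.
  An orbit that is equidistributed or has the right cylinder frequencies is not eventually
  periodic: otherwise all frequencies would be multiples of some \<open>1 / p\<close>, while there are cells
  of arbitrarily small positive measure. Hence it meets every finite set only finitely often, and
  one may count visits to cells instead of visits to cylinders.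

  Equidistribution gives the frequencies of intervals, in particular of cells; conversely a
  continuous function is nearly constant on short cells. If block frequencies along
  multiples of \<open>m\<close> are correct, then occurrences of a word of length \<open>k\<close> are counted correctly up to
  the \<open>k\<close> of \<open>m\<close> positions at the end of each block, and \<open>m\<close> may be taken large. Finally, if \<open>x\<close> is
  normal, then by the mean ergodic theorem for \<open>T\<^sup>m\<close> the averages
  \<open>(1/L) \<Sum>i<L. f (T\<^bsup>mi\<^esup> y)\<close> are close to \<open>\<integral>f d\<mu>\<close> in \<open>L\<^sup>1\<close>; their distance to
  \<open>\<integral>f d\<mu>\<close> is determined by finitely many digits of \<open>y\<close>, so it is small on average along
  \<open>T\<^sup>n x\<close>, hence also along \<open>T\<^bsup>mn\<^esup> x\<close>.
\<close>

section \<open>The mean ergodic theorem\<close>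

definition birkhoff_sum :: "('a \<Rightarrow> 'a) \<Rightarrow> ('a \<Rightarrow> real) \<Rightarrow> nat \<Rightarrow> 'a \<Rightarrow> real" where
  "birkhoff_sum S f n y = (\<Sum>i<n. f ((S ^^ i) y))"

text \<open>The maximum of the Birkhoff sums of lengths 0 to \<open>n\<close>. The recursion splits
  off the first step, so that on the set where the maximum is positive it equals \<open>f y\<close>
  plus the shorter maximum at \<open>S y\<close>.\<close>

primrec max_birkhoff_sum :: "('a \<Rightarrow> 'a) \<Rightarrow> ('a \<Rightarrow> real) \<Rightarrow> nat \<Rightarrow> 'a \<Rightarrow> real" where
  "max_birkhoff_sum S f 0 y = 0"
| "max_birkhoff_sum S f (Suc n) y = max 0 (f y + max_birkhoff_sum S f n (S y))"

lemma birkhoff_sum_Suc: "birkhoff_sum S f (Suc n) y = f y + birkhoff_sum S f n (S y)"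
  unfolding birkhoff_sum_def by (subst sum.lessThan_Suc_shift) (simp add: funpow_swap1)

lemma max_birkhoff_sum_nonneg: "max_birkhoff_sum S f n y \<ge> 0"
  by (cases n) auto

lemma max_birkhoff_sum_mono: "max_birkhoff_sum S f n y \<le> max_birkhoff_sum S f (Suc n) y"
proof (induction n arbitrary: y)
  case (Suc n)
  show ?case using Suc[of "S y"] by simp
qed simp

lemma birkhoff_sum_le_max: "k \<le> n \<Longrightarrow> birkhoff_sum S f k y \<le> max_birkhoff_sum S f n y"
proof (induction n arbitrary: y k)
  case 0
  then show ?case by (simp add: birkhoff_sum_def)
next
  case (Suc n)
  show ?case
  proof (cases k)
    case 0
    then show ?thesis by (simp add: birkhoff_sum_def)
  next
    case (Suc k')
    then show ?thesis using Suc.IH[of k' "S y"] Suc.prems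
      by (simp add: birkhoff_sum_Suc)
  qed
qed

section \<open>Invariant integrals and the maximal inequality\<close>

locale measure_preserving = prob_space M for M :: "'a measure" +
  fixes S :: "'a \<Rightarrow> 'a"
  assumes S_meas [measurable]: "S \<in> measurable M M"
    and S_pres: "distr M M S = M"
begin

lemma integral_compose:
  assumes [measurable]: "f \<in> borel_measurable M"
  shows "(\<integral>y. f (S y) \<partial>M) = (\<integral>y. (f y :: real) \<partial>M)"
  using integral_distr[OF S_meas assms] S_pres by simp

lemma integrable_compose:
  assumes "integrable M f"
  shows "integrable M (\<lambda>y. f (S y) :: real)"
  using integrable_distr_eq[OF S_meas, of f] S_pres assms by simp

lemma integrable_max_birkhoff_sum:
  assumes "integrable M f"
  shows "integrable M (max_birkhoff_sum S f n)"
proof (induction n)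
  case 0
  then show ?case by simp
next
  case (Suc n)
  have "integrable M (\<lambda>y. max 0 (f y + max_birkhoff_sum S f n (S y)))"
    using assms integrable_compose[OF Suc] by (intro integrable_max) auto
  moreover have "max_birkhoff_sum S f (Suc n)
      = (\<lambda>y. max 0 (f y + max_birkhoff_sum S f n (S y)))" by auto
  ultimately show ?case by metis
qed

text \<open>Garsia's argument: on the set where the maximum \<open>m\<close> is positive, \<open>f \<ge> m - m \<circ> S\<close>,
  and the right-hand side has integral zero.\<close>

lemma maximal_ergodic:
  assumes f: "integrable M f"
  shows "0 \<le> (\<integral>y. indicator {y. 0 < max_birkhoff_sum S f (Suc n) y} y * f y \<partial>M)"
proof -
  let ?m = "max_birkhoff_sum S f (Suc n)"
  have i: "integrable M ?m" by (rule integrable_max_birkhoff_sum[OF f])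
  have im: "?m \<in> borel_measurable M" using i by simp
  have "{y. 0 < ?m y} \<inter> space M \<in> sets M"
    using borel_measurable_less[OF _ im, of "\<lambda>_. 0"] by (simp add: Int_def conj_commute)
  then have iA: "integrable M (\<lambda>y. indicator {y. 0 < ?m y} y * f y)"
    using integrable_real_mult_indicator[OF _ f, of "{y. 0 < ?m y} \<inter> space M"]
    by (subst Bochner_Integration.integrable_cong[OF refl,
          of _ _ "\<lambda>y. f y * indicator ({y. 0 < ?m y} \<inter> space M) y"])
       (auto simp: indicator_def)
  have "0 = (\<integral>y. ?m y - ?m (S y) \<partial>M)"
    using i integrable_compose[OF i] integral_compose[OF im]
    by (simp del: max_birkhoff_sum.simps)
  also have "\<dots> \<le> (\<integral>y. indicator {y. 0 < ?m y} y * f y \<partial>M)"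
  proof (rule integral_mono)
    show "integrable M (\<lambda>y. ?m y - ?m (S y))"
      using i integrable_compose[OF i] by (intro Bochner_Integration.integrable_diff)
    show "?m y - ?m (S y) \<le> indicator {y. 0 < ?m y} y * f y" for y
    proof (cases "0 < ?m y")
      case True
      then have "?m y = f y + max_birkhoff_sum S f n (S y)" by auto
      also have "\<dots> \<le> f y + ?m (S y)" using max_birkhoff_sum_mono by (metis add_left_mono)
      finally show ?thesis using True by simp
    next
      case False
      then show ?thesis using max_birkhoff_sum_nonneg[of S f "Suc n" y]
          max_birkhoff_sum_nonneg[of S f "Suc n" "S y"] by (simp del: max_birkhoff_sum.simps)
    qed
  qed (rule iA)
  finally show ?thesis .
qed

text \<open>The sets on which the maxima are positive increase to almost all of the space, so the
  maximal inequality passes to the limit by dominated convergence with bound \<bar>f\<bar>.\<close>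

lemma integral_nonneg_if_birkhoff_sum_pos:
  assumes f: "integrable M f"
    and pos: "AE y in M. \<exists>n. birkhoff_sum S f n y > 0"
  shows "0 \<le> (\<integral>y. f y \<partial>M)"
proof -
  let ?g = "\<lambda>n y. indicator {y. 0 < max_birkhoff_sum S f (Suc n) y} y * f y"
  have "(\<lambda>n. \<integral>y. ?g n y \<partial>M) \<longlonglongrightarrow> (\<integral>y. f y \<partial>M)"
  proof (rule integral_dominated_convergence[where w = "\<lambda>y. \<bar>f y\<bar>"])
    show "AE y in M. (\<lambda>n. ?g n y) \<longlonglongrightarrow> f y"
      using pos
    proof eventually_elim
      case (elim y)
      then obtain k where k: "birkhoff_sum S f k y > 0" by blast
      have "\<forall>\<^sub>F n in sequentially. f y = ?g n y"
        using eventually_ge_at_top[of k]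
      proof eventually_elim
        case (elim n)
        then show ?case using birkhoff_sum_le_max[of k "Suc n" S f y] k by simp
      qed
      then show ?case by (rule tendsto_eventually[OF eventually_mono]) simp
    qed
    fix n
    have m: "max_birkhoff_sum S f (Suc n) \<in> borel_measurable M"
      using integrable_max_birkhoff_sum[OF f, of "Suc n"] by simp
    have "{y\<in>space M. 0 < max_birkhoff_sum S f (Suc n) y} \<in> sets M"
      using borel_measurable_less[OF _ m, of "\<lambda>_. 0"] by simp
    then have "(\<lambda>y. indicator {y\<in>space M. 0 < max_birkhoff_sum S f (Suc n) y} y * f y)
        \<in> borel_measurable M"
      using f by measurable
    then show "?g n \<in> borel_measurable M"
      by (subst measurable_cong) (auto simp: indicator_def)
  qed (use f in \<open>auto simp: indicator_def\<close>)
  then show ?thesis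
    by (rule LIMSEQ_le_const) (use maximal_ergodic[OF f] in blast)
qed

lemma measurable_birkhoff_sum [measurable]:
  assumes [measurable]: "f \<in> borel_measurable M"
  shows "birkhoff_sum S f n \<in> borel_measurable M"
  unfolding birkhoff_sum_def by measurable

section \<open>From the maximal inequality to convergence in mean\<close>

text \<open>The set where the upper limit exceeds \<open>a\<close> is invariant, hence of measure 0
  or 1. If it had measure 1, \<open>f - a\<close> would have a positive Birkhoff sum almost
  everywhere, hence a nonnegative integral, against the choice of \<open>a\<close>.\<close>

lemma ergodic_limsup_le:
  assumes erg: "ergodic_map M S"
    and [measurable]: "f \<in> borel_measurable M" and B: "\<And>y. y \<in> space M \<Longrightarrow> \<bar>f y\<bar> \<le> B"
    and a: "(\<integral>y. f y \<partial>M) < a"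
  shows "AE y in M. limsup (\<lambda>n. ereal (birkhoff_sum S f n y / n)) \<le> a"
proof -
  let ?L = "\<lambda>y. limsup (\<lambda>n. ereal (birkhoff_sum S f n y / n))"
  let ?A = "{y\<in>space M. ereal a < ?L y}"
  have f: "integrable M f"
    by (rule integrable_const_bound[of _ B]) (auto simp: B)
  have A: "?A \<in> sets M" by measurable
  have iter: "(S ^^ n) y \<in> space M" if "y \<in> space M" for n y
    using that by (induction n) (auto intro: measurable_space[OF S_meas])
  \<comment> \<open>The sums of length \<open>n\<close> at \<open>y\<close> and at
    \<open>S y\<close> differ by two values of \<open>f\<close>, hence by at most
    \<open>2 * B\<close>, which vanishes after division by \<open>n\<close>.\<close>
  have inv: "?L (S y) = ?L y" if y: "y \<in> space M" for y
  proof -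
    have d: "birkhoff_sum S f n (S y) = (f ((S ^^ n) y) - f y) + birkhoff_sum S f n y" for n
      using birkhoff_sum_Suc[of S f n y] by (simp add: birkhoff_sum_def)
    have "(\<lambda>n. (f ((S ^^ n) y) - f y) / n) \<longlonglongrightarrow> 0"
    proof (rule tendsto_0_le[where K = 1])
      show "(\<lambda>n. (2 * B) / real n) \<longlonglongrightarrow> 0" by (rule lim_const_over_n)
      have "\<bar>f ((S ^^ n) y) - f y\<bar> \<le> \<bar>2 * B\<bar>" for n
        using B[OF y] B[OF iter[OF y, of n]] by linarith
      then show "\<forall>\<^sub>F n in sequentially.
          norm ((f ((S ^^ n) y) - f y) / real n) \<le> norm (2 * B / real n) * 1"
        by (intro always_eventually allI) (simp only: real_norm_def abs_divide mult_1_right divide_right_mono abs_ge_zero)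
    qed
    then have "(\<lambda>n. ereal ((f ((S ^^ n) y) - f y) / n)) \<longlonglongrightarrow> ereal 0" by simp
    from ereal_limsup_lim_add[OF this, of "\<lambda>n. ereal (birkhoff_sum S f n y / n)"]
    show ?thesis by (simp add: d add_divide_distrib zero_ereal_def[symmetric])
  qed
  have "S -` ?A \<inter> space M = ?A"
    using inv measurable_space[OF S_meas] by auto
  then have "measure M ?A = 0 \<or> measure M ?A = 1"
    using erg A unfolding ergodic_map_def by blast
  moreover have "measure M ?A \<noteq> 1"
  proof
    assume "measure M ?A = 1"
    then have "AE y in M. y \<in> ?A" using prob_eq_1[OF A] by simp
    then have "AE y in M. \<exists>n. birkhoff_sum S (\<lambda>y. f y - a) n y > 0"
    proof eventually_elim
      case (elim y)
      have "\<exists>n>0. a < birkhoff_sum S f n y / n"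
      proof (rule ccontr)
        assume "\<not> ?thesis"
        then have "\<forall>\<^sub>F n in sequentially. ereal (birkhoff_sum S f n y / n) \<le> a"
          by (intro eventually_mono[OF eventually_gt_at_top[of 0]]) (metis \<open>\<not> (\<exists>n>0. a < birkhoff_sum S f n y / n)\<close> ereal_less_eq(3) not_less)
        from Limsup_bounded[OF this] show False using elim by auto
      qed
      then obtain n where n: "a < birkhoff_sum S f n y / n" "n > 0" by blast
      then have "a * n < birkhoff_sum S f n y" by (simp add: field_simps)
      then show ?case by (intro exI[of _ n]) (simp add: birkhoff_sum_def sum_subtractf mult.commute)
    qed
    then have "0 \<le> (\<integral>y. f y - a \<partial>M)"
      using f by (intro integral_nonneg_if_birkhoff_sum_pos) auto
    then show False using a f by (simp add: prob_space)
  qed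
  ultimately have "measure M ?A = 0" by blast
  then have "AE y in M. y \<notin> ?A" using prob_eq_0[OF A] by simp
  then show ?thesis by (rule AE_mp) (auto simp: not_less)
qed

lemma ergodic_limsup_le_integral:
  assumes "ergodic_map M S" "f \<in> borel_measurable M" "\<And>y. y \<in> space M \<Longrightarrow> \<bar>f y\<bar> \<le> B"
  shows "AE y in M. limsup (\<lambda>n. ereal (birkhoff_sum S f n y / n)) \<le> (\<integral>y. f y \<partial>M)"
proof -
  have "AE y in M. \<forall>k::nat. limsup (\<lambda>n. ereal (birkhoff_sum S f n y / n))
      \<le> (\<integral>y. f y \<partial>M) + 1 / Suc k"
    by (subst AE_all_countable, intro allI ergodic_limsup_le[OF assms]) auto
  then show ?thesis
  proof eventually_elim
    case (elim y)
    have "(\<lambda>k. ereal ((\<integral>y. f y \<partial>M) + 1 / Suc k)) \<longlonglongrightarrow> ereal ((\<integral>y. f y \<partial>M) + 0)"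
      by (intro tendsto_intros LIMSEQ_Suc[OF lim_1_over_n])
    from LIMSEQ_le_const[OF this] show ?case using elim by auto
  qed
qed

text \<open>The bound on the upper limit, applied to \<open>f\<close> and to \<open>- f\<close>,
  yields almost sure convergence; as the averages are bounded, dominated convergence turns this into
  convergence in mean.\<close>

theorem mean_ergodic:
  assumes erg: "ergodic_map M S"
    and [measurable]: "f \<in> borel_measurable M" and B: "\<And>y. y \<in> space M \<Longrightarrow> \<bar>f y\<bar> \<le> B"
  shows "(\<lambda>n. \<integral>y. \<bar>birkhoff_sum S f n y / n - (\<integral>y. f y \<partial>M)\<bar> \<partial>M) \<longlonglongrightarrow> 0"
proof -
  let ?c = "\<integral>y. f y \<partial>M"
  have f: "integrable M f"
    by (rule integrable_const_bound[of _ B]) (auto simp: B)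
  have iter: "(S ^^ n) y \<in> space M" if "y \<in> space M" for n y
    using that by (induction n) (auto intro: measurable_space[OF S_meas])
  have "AE y in M. limsup (\<lambda>n. ereal (birkhoff_sum S f n y / n)) \<le> ?c"
    by (rule ergodic_limsup_le_integral[OF erg _ B]) simp_all
  moreover have "AE y in M. limsup (\<lambda>n. ereal (birkhoff_sum S (\<lambda>y. - f y) n y / n)) \<le> (\<integral>y. - f y \<partial>M)"
    by (rule ergodic_limsup_le_integral[OF erg, where B = B]) (simp_all add: B)
  ultimately have "AE y in M. (\<lambda>n. birkhoff_sum S f n y / n) \<longlonglongrightarrow> ?c"
  proof eventually_elim
    case (elim y)
    have "(\<lambda>n. ereal (birkhoff_sum S (\<lambda>y. - f y) n y / n)) = (\<lambda>n. - ereal (birkhoff_sum S f n y / n))"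
      by (simp add: birkhoff_sum_def sum_negf)
    moreover have "ereal (\<integral>y. - f y \<partial>M) = - ereal ?c" by simp
    ultimately have "- liminf (\<lambda>n. ereal (birkhoff_sum S f n y / n)) \<le> - ereal ?c"
      using elim(2) ereal_Limsup_uminus[of sequentially "\<lambda>n. ereal (birkhoff_sum S f n y / n)"]
      by (simp del: uminus_ereal.simps)
    then have "liminf (\<lambda>n. ereal (birkhoff_sum S f n y / n)) \<ge> ?c"
      by (simp only: ereal_minus_le_minus)
    then have "(\<lambda>n. ereal (birkhoff_sum S f n y / n)) \<longlonglongrightarrow> ereal ?c"
      using elim(1) Liminf_le_Limsup[OF trivial_limit_sequentially,
          of "\<lambda>n. ereal (birkhoff_sum S f n y / n)"]
      by (subst tendsto_iff_Liminf_eq_Limsup) auto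
    then show ?case by simp
  qed
  then have ae: "AE y in M. (\<lambda>n. \<bar>birkhoff_sum S f n y / n - ?c\<bar>) \<longlonglongrightarrow> 0"
    by eventually_elim (auto simp: LIM_zero tendsto_rabs_zero)
  have "(\<lambda>n. \<integral>y. \<bar>birkhoff_sum S f n y / n - ?c\<bar> \<partial>M) \<longlonglongrightarrow> (\<integral>y. 0 \<partial>M)"
  proof (rule integral_dominated_convergence[where w = "\<lambda>_. \<bar>B\<bar> + \<bar>?c\<bar>", OF _ _ _ ae])
    fix n
    have "\<bar>birkhoff_sum S f n y / n\<bar> \<le> \<bar>B\<bar>" if "y \<in> space M" for y
    proof -
      have "\<bar>birkhoff_sum S f n y\<bar> \<le> (\<Sum>i<n. \<bar>f ((S ^^ i) y)\<bar>)"
        unfolding birkhoff_sum_def by (rule sum_abs)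
      also have "\<dots> \<le> n * \<bar>B\<bar>"
        using sum_bounded_above[of "{..<n}" "\<lambda>i. \<bar>f ((S ^^ i) y)\<bar>" "\<bar>B\<bar>"]
          order_trans[OF B[OF iter[OF that]] abs_ge_self] by simp
      finally show ?thesis by (cases "n = 0") (auto simp: field_simps)
    qed
    then have "\<bar>birkhoff_sum S f n y / n - ?c\<bar> \<le> \<bar>B\<bar> + \<bar>?c\<bar>" if "y \<in> space M" for y
      using that by (intro order_trans[OF abs_triangle_ineq4 add_mono]) auto
    then show "AE y in M. norm \<bar>birkhoff_sum S f n y / n - ?c\<bar> \<le> \<bar>B\<bar> + \<bar>?c\<bar>"
      by (intro AE_I2) simp
  qed auto
  then show ?thesis by simp
qed

end

section \<open>Averages along a sequence\<close>

text \<open>The sequence is arbitrary so that it can be an orbit of any power of \<open>T\<close>.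
  At \<open>N = 0\<close> the value is 0 by division by zero, which is why \<open>avg_const\<close>
  asks for \<open>N > 0\<close>.\<close>

definition avg :: "('a \<Rightarrow> real) \<Rightarrow> (nat \<Rightarrow> 'a) \<Rightarrow> nat \<Rightarrow> real" where
  "avg f z N = (\<Sum>n<N. f (z n)) / real N"

lemma avg_sum: "avg (\<lambda>y. \<Sum>w\<in>F. h w * g w y) z N = (\<Sum>w\<in>F. h w * avg (g w) z N)"
  unfolding avg_def by (subst sum.swap) (simp add: sum_distrib_left sum_divide_distrib)

lemma avg_mono: "(\<And>n. f (z n) \<le> g (z n)) \<Longrightarrow> avg f z N \<le> avg g z N"
  unfolding avg_def by (intro divide_right_mono sum_mono) auto

lemma avg_const: "N > 0 \<Longrightarrow> avg (\<lambda>_. c) z N = c"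
  by (simp add: avg_def)

lemma avg_add: "avg (\<lambda>y. f y + g y) z N = avg f z N + avg g z N"
  by (simp add: avg_def sum.distrib add_divide_distrib)

lemma avg_diff: "avg (\<lambda>y. f y - g y) z N = avg f z N - avg g z N"
  by (simp add: avg_def sum_subtractf diff_divide_distrib)

lemma avg_cmult: "avg (\<lambda>y. c * f y) z N = c * avg f z N"
  by (simp add: avg_def sum_distrib_left)

lemma abs_avg_le: "\<bar>avg f z N\<bar> \<le> avg (\<lambda>y. \<bar>f y\<bar>) z N"
  by (simp add: avg_def divide_right_mono)

section \<open>Approximation by step functions\<close>

text \<open>The function is compared with the step function taking the value \<open>h w\<close> on
  \<open>E w\<close>. The error is at most \<open>e\<close> on the finitely many given sets and at
  most \<open>B\<close> off them, and both the measure and the eventual frequency of the uncovered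
  part are small.\<close>

lemma (in prob_space) avg_close:
  assumes F: "finite F" and E: "\<And>w. w \<in> F \<Longrightarrow> E w \<in> sets M"
    and dis: "disjoint_family_on E F" and cov: "1 - e \<le> measure M (\<Union>w\<in>F. E w)"
    and f [measurable]: "f \<in> borel_measurable M" and B: "\<And>y. y \<in> space M \<Longrightarrow> \<bar>f y\<bar> \<le> B"
    and z: "\<And>n. z n \<in> space M"
    and conv: "\<And>w. w \<in> F \<Longrightarrow> (\<lambda>N. avg (indicator (E w)) z N) \<longlonglongrightarrow> measure M (E w)"
    and osc: "\<And>w y. w \<in> F \<Longrightarrow> y \<in> E w \<Longrightarrow> \<bar>f y - h w\<bar> \<le> e" and e: "e > 0"
  shows "\<forall>\<^sub>F N in sequentially. \<bar>avg f z N - (\<integral>y. f y \<partial>M)\<bar> \<le> 3 * (1 + B) * e"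
proof -
  \<comment> \<open>\<open>s\<close> is the step function, and \<open>q\<close> is the indicator of
    the covered part, so \<open>1 - q\<close> marks where only the bound \<open>B\<close> is
    available.\<close>
  define s q where "s = (\<lambda>y. \<Sum>w\<in>F. h w * indicator (E w) y)"
    and "q = (\<lambda>y. \<Sum>w\<in>F. 1 * (indicator (E w) y :: real))"
  have B0: "B \<ge> 0" using B[OF z[of 0]] by linarith
  have ie: "integrable M (indicator (E w) :: _ \<Rightarrow> real)" if "w \<in> F" for w
    using E[OF that] by (simp add: emeasure_eq_measure)
  have ints: "integrable M s" unfolding s_def
    by (intro Bochner_Integration.integrable_sum integrable_mult_right ie)
  have iq: "integrable M q" unfolding q_def
    by (intro Bochner_Integration.integrable_sum integrable_mult_right ie)
  have if': "integrable M f" by (rule integrable_const_bound[of _ B]) (auto simp: B)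
  have int: "(\<integral>y. (\<Sum>w\<in>F. k w * indicator (E w) y) \<partial>M) = (\<Sum>w\<in>F. k w * measure M (E w))" for k :: "_ \<Rightarrow> real"
    using E sets.sets_into_space by (subst Bochner_Integration.integral_sum) (auto intro!: integrable_mult_right ie sum.cong simp: Int_absorb2)
  have lim: "(\<lambda>N. avg (\<lambda>y. \<Sum>w\<in>F. k w * indicator (E w) y) z N) \<longlonglongrightarrow> (\<Sum>w\<in>F. k w * measure M (E w))" for k :: "_ \<Rightarrow> real"
    unfolding avg_sum by (intro tendsto_sum tendsto_mult_left conv)
  have "measure M (\<Union>w\<in>F. E w) = (\<Sum>w\<in>F. measure M (E w))"
    using F E dis by (intro finite_measure_finite_Union) auto
  then have iqe: "(\<integral>y. q y \<partial>M) \<ge> 1 - e" unfolding q_def int using cov by simp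
  have close: "\<bar>f y - s y\<bar> \<le> e + B * (1 - q y)" if y: "y \<in> space M" for y
  proof (cases "\<exists>w\<in>F. y \<in> E w")
    case True
    then obtain w where w: "w \<in> F" "y \<in> E w" by blast
    have ind: "indicator (E v) y = (if v = w then 1 else 0 :: real)" if "v \<in> F" for v
      using dis w that by (auto simp: disjoint_family_on_def indicator_def)
    have "(\<Sum>v\<in>F. k v * indicator (E v) y) = k w" for k :: "_ \<Rightarrow> real"
    proof -
      have "(\<Sum>v\<in>F. k v * indicator (E v) y) = (\<Sum>v\<in>F. if v = w then k v else 0)"
        by (rule sum.cong) (simp_all add: ind)
      also have "\<dots> = k w" using w F by simp
      finally show ?thesis .
    qed
    from this[of h] this[of "\<lambda>_. 1"] have "s y = h w" "q y = 1"
      by (simp_all only: s_def q_def)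
    then show ?thesis using osc[OF w] by simp
  next
    case False
    then have "s y = 0" "q y = 0" by (auto simp: s_def q_def intro!: sum.neutral)
    then show ?thesis using B[OF y] e by simp
  qed
  have "\<bar>(\<integral>y. f y \<partial>M) - (\<integral>y. s y \<partial>M)\<bar> = \<bar>\<integral>y. f y - s y \<partial>M\<bar>" using ints if' by simp
  also have "\<dots> \<le> (\<integral>y. \<bar>f y - s y\<bar> \<partial>M)" by (rule integral_abs_bound)
  also have "\<dots> \<le> (\<integral>y. e + B * (1 - q y) \<partial>M)"
    using ints if' iq close by (intro integral_mono) auto
  also have "\<dots> = e + B * (1 - (\<integral>y. q y \<partial>M))" using iq by (simp add: prob_space)
  also have "\<dots> \<le> e + B * e" using iqe B0 by (intro add_left_mono mult_left_mono) auto
  finally have 1: "\<bar>(\<integral>y. f y \<partial>M) - (\<integral>y. s y \<partial>M)\<bar> \<le> e + B * e" .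
  have ls: "avg s z \<longlonglongrightarrow> (\<integral>y. s y \<partial>M)" using lim[of h] int[of h] unfolding s_def by simp
  have lq: "avg q z \<longlonglongrightarrow> (\<integral>y. q y \<partial>M)" using lim[of "\<lambda>_. 1"] int[of "\<lambda>_. 1"] unfolding q_def by simp
  have "\<forall>\<^sub>F N in sequentially. \<bar>avg s z N - (\<integral>y. s y \<partial>M)\<bar> < e"
    using tendstoD[OF ls e] by (simp add: dist_real_def)
  moreover have "\<forall>\<^sub>F N in sequentially. \<bar>avg q z N - (\<integral>y. q y \<partial>M)\<bar> < e"
    using tendstoD[OF lq e] by (simp add: dist_real_def)
  ultimately show ?thesis using eventually_gt_at_top[of 0]
  proof eventually_elim
    case (elim N)
    have "\<bar>avg f z N - avg s z N\<bar> \<le> avg (\<lambda>y. \<bar>f y - s y\<bar>) z N"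
      unfolding avg_diff[symmetric] by (rule abs_avg_le)
    also have "\<dots> \<le> avg (\<lambda>y. e + B * (1 - q y)) z N" by (intro avg_mono close z)
    also have "\<dots> = e + B * (1 - avg q z N)"
      using elim(3) by (simp add: avg_add avg_cmult avg_diff avg_const)
    \<comment> \<open>The integral of \<open>q\<close> is at least \<open>1 - e\<close> and its
      average is within \<open>e\<close> of that integral.\<close>
    also have "\<dots> \<le> e + B * (2 * e)"
      using iqe elim(2) B0 by (intro add_left_mono mult_left_mono) auto
    finally have "\<bar>avg f z N - (\<integral>y. f y \<partial>M)\<bar> \<le> (e + B * (2 * e)) + e + (e + B * e)"
      using 1 elim(1) by linarith
    then show ?case by (simp add: algebra_simps)
  qed
qed

text \<open>Continuity of the measure from below along an enumeration of \<open>W\<close>; the empty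
  family is separate because it has no enumeration.\<close>

lemma (in prob_space) finite_subcover_up_to:
  assumes W: "countable W" and E: "\<And>w. w \<in> W \<Longrightarrow> E w \<in> sets M"
    and cov: "measure M (\<Union>w\<in>W. E w) = c" and e: "e > 0"
  obtains F where "finite F" "F \<subseteq> W" "c - e \<le> measure M (\<Union>w\<in>F. E w)"
proof (cases "W = {}")
  case True
  then show ?thesis using that[of "{}"] cov e by simp
next
  case False
  let ?A = "\<lambda>n. \<Union>i<n. E (from_nat_into W i)"
  have r: "range (from_nat_into W) = W" by (rule range_from_nat_into[OF False W])
  have "range ?A \<subseteq> sets M" using from_nat_into[OF False] E by auto
  moreover have "incseq ?A" by (auto simp: incseq_def intro: less_le_trans)
  ultimately have "(\<lambda>n. measure M (?A n)) \<longlonglongrightarrow> measure M (\<Union>n. ?A n)"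
    by (rule finite_Lim_measure_incseq)
  moreover have "(\<Union>n. ?A n) = (\<Union>w\<in>W. E w)"
    by (subst (2) r[symmetric]) auto
  ultimately have "(\<lambda>n. measure M (?A n)) \<longlonglongrightarrow> c" using cov by simp
  from tendstoD[OF this e] obtain n where "dist (measure M (?A n)) c < e"
    unfolding eventually_sequentially by blast
  then have "c - e \<le> measure M (?A n)" by (simp add: dist_real_def)
  moreover have "?A n = (\<Union>w\<in>from_nat_into W ` {..<n}. E w)" by auto
  ultimately show ?thesis
    using from_nat_into[OF False] by (auto intro!: that[of "from_nat_into W ` {..<n}"] simp del: UN_simps)
qed

lemma (in prob_space) avg_tendsto_cells:
  assumes W: "countable W" and E: "\<And>w. w \<in> W \<Longrightarrow> E w \<in> sets M"
    and dis: "disjoint_family_on E W" and cov: "measure M (\<Union>w\<in>W. E w) = 1"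
    and f: "f \<in> borel_measurable M" and B: "\<And>y. y \<in> space M \<Longrightarrow> \<bar>f y\<bar> \<le> B"
    and z: "\<And>n. z n \<in> space M"
    and conv: "\<And>w. w \<in> W \<Longrightarrow> (\<lambda>N. avg (indicator (E w)) z N) \<longlonglongrightarrow> measure M (E w)"
    and h: "\<And>w y. w \<in> W \<Longrightarrow> y \<in> E w \<Longrightarrow> f y = h w"
  shows "(\<lambda>N. avg f z N) \<longlonglongrightarrow> (\<integral>y. f y \<partial>M)"
proof (rule tendstoI)
  fix r :: real assume r: "r > 0"
  have B0: "B \<ge> 0" using B[OF z[of 0]] by linarith
  define e where "e = r / (6 * (1 + B))"
  have "3 * (1 + B) * e = r / 2" using B0 by (simp add: e_def field_simps)
  then have e: "e > 0" "3 * (1 + B) * e < r" using r B0 by (auto simp: e_def)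
  obtain F where F: "finite F" "F \<subseteq> W" "1 - e \<le> measure M (\<Union>w\<in>F. E w)"
    using finite_subcover_up_to[OF W E cov e(1)] by blast
  have "\<forall>\<^sub>F N in sequentially. \<bar>avg f z N - (\<integral>y. f y \<partial>M)\<bar> \<le> 3 * (1 + B) * e"
  proof (rule avg_close[where h = h, OF F(1) _ _ F(3) f B z])
    show "disjoint_family_on E F" using dis F(2) by (auto simp: disjoint_family_on_def)
    show "\<bar>f y - h w\<bar> \<le> e" if "w \<in> F" "y \<in> E w" for w y using h[of w y] that F(2) e by auto
  qed (use F(2) E conv e in auto)
  then show "\<forall>\<^sub>F N in sequentially. dist (avg f z N) (\<integral>y. f y \<partial>M) < r"
    by eventually_elim (use e in \<open>auto simp: dist_real_def\<close>)
qed

section \<open>Block averages, periodic sequences, finite exceptions\<close>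

text \<open>Rounding \<open>N\<close> down to a multiple of \<open>m\<close> drops fewer than
  \<open>m\<close> terms, each in [0,1]. This costs at most a constant divided by \<open>N\<close>,
  eventually below a second \<open>d\<close>.\<close>

lemma average_from_blocks:
  fixes a :: "nat \<Rightarrow> real"
  assumes a: "\<And>n. 0 \<le> a n" "\<And>n. a n \<le> 1" and m: "m > 0" and d: "d > 0"
    and ev: "\<forall>\<^sub>F N in sequentially. \<bar>(\<Sum>n<m * N. a n) / real (m * N) - c\<bar> \<le> d"
  shows "\<forall>\<^sub>F N in sequentially. \<bar>(\<Sum>n<N. a n) / real N - c\<bar> \<le> 2 * d"
proof -
  have "filterlim (\<lambda>N. N div m) at_top sequentially"
    unfolding filterlim_at_top
  proof
    fix Z
    show "\<forall>\<^sub>F N in sequentially. Z \<le> N div m"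
      using eventually_ge_at_top[of "Z * m"]
      by eventually_elim (use m in \<open>simp add: less_eq_div_iff_mult_less_eq\<close>)
  qed
  then have "\<forall>\<^sub>F N in sequentially. \<bar>(\<Sum>n<m * (N div m). a n) / real (m * (N div m)) - c\<bar> \<le> d"
    unfolding filterlim_iff using ev by blast
  moreover have "\<forall>\<^sub>F N in sequentially. N \<ge> m"  by (rule eventually_ge_at_top)
  \<comment> \<open>The dropped terms change the sum by at most \<open>m\<close> and the target
    \<open>c * N\<close> by at most \<open>\<bar>c\<bar> * m\<close>; beyond this threshold both
    together stay below \<open>d * N\<close>.\<close>
  moreover have "\<forall>\<^sub>F N in sequentially. real N \<ge> m * (1 + \<bar>c\<bar>) / d"
    by (rule filterlim_real_sequentially[unfolded filterlim_at_top, rule_format])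
  ultimately show ?thesis
  proof eventually_elim
    case (elim N)
    define K where "K = m * (N div m)"
    have K: "K \<le> N" "N - K < m" using m by (auto simp: K_def minus_mult_div_eq_mod)
    have "N div m > 0" using m elim(2) by (simp add: div_greater_zero_iff)
    then have K0: "K > 0" using m unfolding K_def by (rule_tac mult_pos_pos)
    define A where "A = (\<lambda>k. \<Sum>n<k. a n)"
    have "A N = A K + (\<Sum>n\<in>{K..<N}. a n)"
      using sum.atLeastLessThan_concat[of 0 K N a] K unfolding A_def lessThan_atLeast0 by simp
    moreover have "(\<Sum>n\<in>{K..<N}. a n) \<le> m"
      using sum_bounded_above[of "{K..<N}" a 1] a(2) K by simp
    moreover have "0 \<le> (\<Sum>n\<in>{K..<N}. a n)" using a(1) by (rule sum_nonneg)
    ultimately have 1: "\<bar>A N - A K\<bar> \<le> m" by simp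
    have "\<bar>A K / K - c\<bar> \<le> d" using elim(1) by (simp add: A_def K_def)
    moreover have "\<bar>A K - c * K\<bar> = \<bar>A K / K - c\<bar> * K"
      using K0 by (simp add: abs_if field_simps)
    ultimately have 2: "\<bar>A K - c * K\<bar> \<le> d * K"
      using K0 by (simp add: mult_right_mono)
    have "\<bar>c * K - c * N\<bar> = \<bar>c\<bar> * real (N - K)"
      using K by (simp add: abs_mult of_nat_diff flip: right_diff_distrib)
    also have "\<dots> \<le> \<bar>c\<bar> * m" using K by (intro mult_left_mono) auto
    finally have "\<bar>A N - c * N\<bar> \<le> d * K + m + \<bar>c\<bar> * m" using 1 2 by linarith
    also have "\<dots> \<le> d * N + d * N"
    proof -
      have "d * K \<le> d * N" using d K(1) by simp
      moreover have "m + \<bar>c\<bar> * m \<le> d * N" using elim(3) d by (simp add: field_simps)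
      ultimately show ?thesis by linarith
    qed
    finally have "\<bar>A N - c * N\<bar> \<le> 2 * d * N" by simp
    moreover have "\<bar>A N / N - c\<bar> = \<bar>A N - c * N\<bar> / N"
      using K K0 by (simp add: abs_if field_simps)
    ultimately show ?case using K K0 by (simp add: A_def field_simps)
  qed
qed

text \<open>A visit at time \<open>j\<close> is repeated at all times \<open>j + p * t\<close>, so
  there are at least \<open>K\<close> visits before time \<open>j + p * K\<close>.\<close>

lemma avg_eventually_periodic_visit:
  assumes p: "p > 0" and per: "\<And>n. n \<ge> i \<Longrightarrow> z (n + p) = z n"
    and lim: "(\<lambda>N. avg (indicator E) z N) \<longlonglongrightarrow> c" and j: "j \<ge> i" "z j \<in> E"
  shows "c \<ge> 1 / p"
proof -
  have zj: "z (j + p * t) = z j" for t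
    by (induction t) (use per j in \<open>auto simp: add.assoc[symmetric] add.commute[of p]\<close>)
  have 1: "avg (indicator E) z (j + p * K) \<ge> real K / real (j + p * K)" for K
  proof -
    have "real K = (\<Sum>n\<in>(\<lambda>t. j + p * t) ` {..<K}. indicator E (z n))"
      using p zj j by (subst sum.reindex) (auto simp: inj_on_def)
    also have "\<dots> \<le> (\<Sum>n<j + p * K. indicator E (z n))"
      using p by (intro sum_mono2) auto
    finally show ?thesis unfolding avg_def by (rule divide_right_mono) simp
  qed
  have "(\<lambda>K. avg (indicator E) z (j + p * K)) \<longlonglongrightarrow> c"
    using p by (intro filterlim_compose[OF lim] filterlim_subseq) (auto simp: strict_mono_def)
  moreover have "(\<lambda>K. real K / real (j + p * K)) \<longlonglongrightarrow> 1 / p"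
    using p by (real_asymp simp: inverse_eq_divide)
  ultimately show ?thesis using 1 by (intro LIMSEQ_le) auto
qed

text \<open>A positive frequency forces a visit after the sequence has become periodic, since at
  most \<open>i\<close> visits would give limit 0.\<close>

lemma avg_eventually_periodic:
  assumes p: "p > 0" and per: "\<And>n. n \<ge> i \<Longrightarrow> z (n + p) = z n"
    and lim: "(\<lambda>N. avg (indicator E) z N) \<longlonglongrightarrow> c" and c: "c > 0"
  shows "c \<ge> 1 / p"
proof (cases "\<exists>j\<ge>i. z j \<in> E")
  case True
  then show ?thesis using avg_eventually_periodic_visit[OF p per lim] by blast
next
  case False
  have "avg (indicator E) z N \<le> real i / N" for N
  proof -
    have "(\<Sum>n<N. indicator E (z n)) = (\<Sum>n\<in>{..<N} \<inter> {..<i}. indicator E (z n) :: real)"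
      using False by (intro sum.mono_neutral_right) (auto simp: indicator_eq_0_iff not_less[symmetric])
    also have "\<dots> \<le> real (card ({..<N} \<inter> {..<i}))"
      using sum_bounded_above[of "{..<N} \<inter> {..<i}" "\<lambda>n. indicator E (z n) :: real" 1] by simp
    also have "\<dots> \<le> i" using card_mono[of "{..<i}" "{..<N} \<inter> {..<i}"] by simp
    finally show ?thesis unfolding avg_def by (rule divide_right_mono) simp
  qed
  then have "c \<le> 0" by (intro LIMSEQ_le[OF lim lim_const_over_n]) auto
  then show ?thesis using c by simp
qed

lemma avg_cong_cofinite:
  assumes fin: "finite {n. f (z n) \<noteq> g (z n)}" and lim: "(\<lambda>N. avg f z N) \<longlonglongrightarrow> c"
  shows "(\<lambda>N. avg g z N) \<longlonglongrightarrow> c"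
proof -
  let ?X = "{n. f (z n) \<noteq> g (z n)}"
  obtain k where k: "?X \<subseteq> {..<k}" using finite_nat_bounded[OF fin] by blast
  have "\<forall>\<^sub>F N in sequentially. avg g z N = avg f z N + (\<Sum>n<k. g (z n) - f (z n)) / real N"
    using eventually_ge_at_top[of k]
  proof eventually_elim
    case (elim N)
    have "(\<Sum>n<N. g (z n) - f (z n)) = (\<Sum>n<k. g (z n) - f (z n))"
      using k elim by (intro sum.mono_neutral_right) force+
    then have "(\<Sum>n<N. g (z n)) = (\<Sum>n<N. f (z n)) + (\<Sum>n<k. g (z n) - f (z n))"
      by (simp add: sum_subtractf)
    then show ?case by (simp add: avg_def add_divide_distrib)
  qed
  moreover have "(\<lambda>N. avg f z N + (\<Sum>n<k. g (z n) - f (z n)) / real N) \<longlonglongrightarrow> c + 0"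
    by (intro tendsto_add lim lim_const_over_n)
  ultimately show ?thesis by (simp add: filterlim_cong[OF refl refl])
qed

section \<open>Cells\<close>

text \<open>The sets that contain \<open>Q\<close> or miss it are closed under complements and
  countable unions.\<close>

lemma sigma_sets_subset_or_disjoint:
  assumes "A \<in> sigma_sets X G" and "\<And>A. A \<in> G \<Longrightarrow> Q \<subseteq> A \<or> Q \<inter> A = {}" and "Q \<subseteq> X"
  shows "Q \<subseteq> A \<or> Q \<inter> A = {}"
  using assms(1)
proof induction
  case (Compl A)
  then show ?case using assms(3) by blast
next
  case (Union A)
  then show ?case by blast
qed (use assms(2) in auto)

text \<open>A point of the interval other than its infimum and supremum lies strictly between two
  points of it, hence in the interior.\<close>

lemma finite_interval_minus_interior:
  fixes S :: "real set"
  assumes S: "is_interval S" "bdd_below S" "bdd_above S"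
  shows "finite (S - interior S)"
proof (rule finite_subset)
  show "S - interior S \<subseteq> {Inf S, Sup S}"
  proof
    fix y assume y: "y \<in> S - interior S"
    show "y \<in> {Inf S, Sup S}"
    proof (rule ccontr)
      assume "y \<notin> {Inf S, Sup S}"
      then have "Inf S < y" "y < Sup S"
        using y cInf_lower[OF _ S(2), of y] cSup_upper[OF _ S(3), of y] by auto
      then obtain u v where uv: "u \<in> S" "u < y" "v \<in> S" "y < v"
        using y S by (metis DiffE cInf_less_iff empty_iff less_cSup_iff)
      then have "{u<..<v} \<subseteq> S"
        using S(1) by (meson greaterThanLessThan_iff is_interval_1 less_imp_le subsetI)
      then have "y \<in> interior S" using uv by (intro interiorI[of "{u<..<v}"]) auto
      then show False using y by blast
    qed
  qed
qed simp

text \<open>An open set that misses \<open>interior J\<close> misses its closure, which contains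
  \<open>J\<close> because \<open>J\<close> is convex with nonempty interior.\<close>

lemma interior_Int_interval_empty:
  fixes S J :: "real set"
  assumes "interior S \<inter> interior J = {}" "is_interval J" "interior J \<noteq> {}"
  shows "interior S \<inter> J = {}"
proof -
  have "closure (interior J) = closure J"
    using assms by (intro convex_closure_interior) (auto simp: is_interval_convex_1)
  moreover have "interior S \<inter> closure (interior J) = {}"
    using assms(1) by (simp add: open_Int_closure_eq_empty)
  ultimately show ?thesis using closure_subset[of J] by blast
qed

section \<open>The system and its null sets\<close>

locale f_system =
  fixes T :: "real \<Rightarrow> real" and \<mu> :: "real measure" and D :: "'d set" and I :: "'d \<Rightarrow> real set"
  assumes F_system: "F_system T \<mu> D I"
begin

sublocale prob_space \<mu>
  using F_system by (simp add: F_system_def)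

lemma sets_\<mu>: "sets \<mu> = sets (restrict_space borel {0..1})"
  using F_system by (simp add: F_system_def unit_borel_def)

lemma in_sets_\<mu>: "A \<in> sets \<mu> \<longleftrightarrow> A \<in> sets borel \<and> A \<subseteq> {0..1}"
  unfolding sets_\<mu> by (subst sets_restrict_space_iff) auto

lemma space_\<mu> [simp]: "space \<mu> = {0..1}"
  using sets_eq_imp_space_eq[OF sets_\<mu>] by (simp add: space_restrict_space)

sublocale measure_preserving \<mu> T
  using F_system by unfold_locales (auto simp: F_system_def)

lemma iter_in: "y \<in> {0..1} \<Longrightarrow> (T ^^ n) y \<in> {0..1}"
  using measurable_space[OF S_meas] by (induction n) (simp_all del: atLeastAtMost_iff)

lemma iter_measurable [measurable]: "T ^^ n \<in> measurable \<mu> \<mu>"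
proof (induction n)
  case (Suc n)
  then show ?case using measurable_comp[OF Suc S_meas] by simp
qed simp

lemma distr_iter: "distr \<mu> \<mu> (T ^^ n) = \<mu>"
proof (induction n)
  case 0
  show ?case by (simp add: id_def distr_id)
next
  case (Suc n)
  have "distr \<mu> \<mu> (T ^^ Suc n) = distr (distr \<mu> \<mu> (T ^^ n)) \<mu> T"
    by (subst distr_distr) simp_all
  then show ?case using Suc S_pres by (simp only:)
qed

lemma measure_preserving_iter: "measure_preserving \<mu> (T ^^ n)"
  by unfold_locales (simp_all add: distr_iter)

lemma AE_iter:
  assumes "AE y in \<mu>. P y" shows "AE y in \<mu>. P ((T ^^ n) y)"
proof -
  have "AE y in distr \<mu> \<mu> (T ^^ n). P y" using assms by (simp only: distr_iter)
  then show ?thesis by (rule AE_distrD[OF iter_measurable])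
qed

lemma null_if_lebesgue_null:
  assumes "N \<in> null_sets unit_lebesgue" shows "N \<in> null_sets \<mu>"
  using F_system assms by (auto simp: F_system_def absolutely_continuous_def)

lemma null_finite:
  assumes "finite N" "N \<subseteq> {0..1}" shows "N \<in> null_sets \<mu>"
proof (rule null_if_lebesgue_null)
  show "N \<in> null_sets unit_lebesgue"
    unfolding unit_lebesgue_def using assms
    by (subst null_sets_restrict_space) (auto intro: finite_imp_null_set_lborel)
qed

lemma countable_D: "countable D"
  and interval_I: "j \<in> D \<Longrightarrow> is_interval (I j)"
  and I_subset: "j \<in> D \<Longrightarrow> I j \<subseteq> {0..1}"
  using F_system by (auto simp: F_system_def interval_partition_def)

lemma countable_words: "countable (words D k)"
  unfolding words_def using countable_D
  by (intro countable_subset[OF _ countable_lists[of D]]) auto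

lemma interior_disjoint:
  assumes "i \<in> D" "j \<in> D" "i \<noteq> j" shows "interior (I i) \<inter> I j = {}"
proof (rule interior_Int_interval_empty)
  have "interval_partition D I" using F_system by (simp add: F_system_def)
  then show "interior (I i) \<inter> interior (I j) = {}" "interior (I j) \<noteq> {}"
    using assms unfolding interval_partition_def by blast+
qed (rule interval_I[OF assms(2)])

lemma finite_boundary:
  assumes "j \<in> D" shows "finite (I j - interior (I j))"
  using bdd_below_mono[OF bdd_below_Icc I_subset[OF assms]]
    bdd_above_mono[OF bdd_above_Icc I_subset[OF assms]]
  by (rule finite_interval_minus_interior[OF interval_I[OF assms]])

lemma I_sets: "j \<in> D \<Longrightarrow> I j \<in> sets \<mu>"
  using I_subset interval_I by (simp add: in_sets_\<mu> real_interval_borel_measurable)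

lemma interior_sets: "j \<in> D \<Longrightarrow> interior (I j) \<in> sets \<mu>"
  using order_trans[OF interior_subset I_subset] by (simp only: in_sets_\<mu> open_interior borel_open)

text \<open>Each interval has finitely many boundary points and there are countably many intervals;
  invariance of \<mu> carries the null set to all iterates.\<close>

lemma AE_not_boundary: "AE y in \<mu>. \<forall>n. \<forall>j\<in>D. (T ^^ n) y \<notin> I j - interior (I j)"
proof -
  have "AE y in \<mu>. y \<notin> I j - interior (I j)" if "j \<in> D" for j
    using that null_finite[OF finite_boundary[OF that]] I_subset[OF that]
    by (intro AE_not_in) auto
  from AE_iter[OF this] show ?thesis
    by (subst AE_all_countable, intro allI, subst AE_ball_countable[OF countable_D]) blast
qed

lemma AE_interior: "AE y in \<mu>. \<forall>n. \<exists>j\<in>D. (T ^^ n) y \<in> interior (I j)"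
proof -
  have "{0..1} - (\<Union>j\<in>D. I j) \<in> null_sets \<mu>"
    using F_system null_if_lebesgue_null by (auto simp: F_system_def interval_partition_def)
  then have "AE y in \<mu>. y \<notin> {0..1} - (\<Union>j\<in>D. I j)" by (rule AE_not_in)
  then have "AE y in \<mu>. \<exists>j\<in>D. y \<in> interior (I j)"
    using AE_not_boundary AE_space
  proof eventually_elim
    case (elim y)
    then obtain j where "j \<in> D" "y \<in> I j" by auto
    moreover have "y \<notin> I j - interior (I j)"
      using elim(2)[rule_format, of j 0] \<open>j \<in> D\<close> by simp
    ultimately show ?case by blast
  qed
  from AE_iter[OF this] show ?thesis by (subst AE_all_countable) blast
qed

section \<open>Cells and cylinders\<close>

text \<open>Interiors are used because the intervals may share endpoints: cells of equal length are
  then disjoint, and the branches are monotone on them.\<close>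

definition cell :: "'d list \<Rightarrow> real set" where
  "cell W = {y\<in>{0..1}. \<forall>i<length W. (T ^^ i) y \<in> interior (I (W ! i))}"

text \<open>The cylinder with the intervals as given; unlike \<open>cylinder_set\<close> it may
  contain the point 1, so that it also describes orbits that visit 1.\<close>

definition cyl :: "'d list \<Rightarrow> real set" where
  "cyl W = {y\<in>{0..1}. \<forall>i<length W. (T ^^ i) y \<in> I (W ! i)}"

lemma cell_Cons: "cell (v # W) = {y \<in> {0..1}. y \<in> interior (I v) \<and> T y \<in> cell W}"
proof -
  have "y \<in> {0..1} \<Longrightarrow> T y \<in> {0..1}" for y using iter_in[of y 1] by simp
  then show ?thesis
    unfolding cell_def by (auto simp: All_less_Suc2 funpow_swap1)
qed

text \<open>Induction on the word: a monotone branch sends a point between \<open>u\<close> and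
  \<open>w\<close> to a point between \<open>T u\<close> and \<open>T w\<close>, possibly with
  reversed order, and both of these lie in the cell of the tail.\<close>

lemma cell_ordered:
  assumes "set W \<subseteq> D" "u \<in> cell W" "w \<in> cell W" "u \<le> y" "y \<le> w"
  shows "y \<in> cell W"
  using assms
proof (induction W arbitrary: u w y)
  case Nil
  then show ?case by (auto simp: cell_def)
next
  case (Cons v W)
  from Cons.prems have v: "v \<in> D" and uw: "u \<in> interior (I v)" "w \<in> interior (I v)"
      "T u \<in> cell W" "T w \<in> cell W" "0 \<le> u" "w \<le> 1"
    by (auto simp: cell_Cons)
  have "convex (interior (I v))" using interval_I[OF v] by (intro convex_interior) (simp add: is_interval_convex_1)
  then have y: "y \<in> interior (I v)"
    using uw Cons.prems(4,5) by (meson is_interval_1 is_interval_convex_1)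
  have "strict_mono_on (interior (I v)) T \<or> strict_antimono_on (interior (I v)) T"
    using F_system v by (auto simp: F_system_def)
  then have "(T u \<le> T y \<and> T y \<le> T w) \<or> (T w \<le> T y \<and> T y \<le> T u)"
  proof
    assume "strict_mono_on (interior (I v)) T"
    then show ?thesis using uw y Cons.prems(4,5)
      by (metis strict_mono_on_leD)
  next
    assume "strict_antimono_on (interior (I v)) T"
    then have "a \<le> b \<Longrightarrow> a \<in> interior (I v) \<Longrightarrow> b \<in> interior (I v) \<Longrightarrow> T b \<le> T a" for a b
      by (metis monotone_onD order_le_less)
    then show ?thesis using uw y Cons.prems(4,5) by blast
  qed
  moreover have "set W \<subseteq> D" using Cons.prems(1) by simp
  ultimately have "T y \<in> cell W"
    using Cons.IH[of "T u" "T w" "T y"] Cons.IH[of "T w" "T u" "T y"] uw(3,4) by blast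
  then show ?case using y uw Cons.prems(4,5) by (simp add: cell_Cons)
qed

lemma iter_vimage_sets: "A \<in> sets \<mu> \<Longrightarrow> {y\<in>{0..1}. (T ^^ n) y \<in> A} \<in> sets \<mu>"
  using measurable_sets[OF iter_measurable, of A n] by (simp add: vimage_def Int_def conj_commute)

lemma itinerary_sets:
  assumes "\<And>i. i < n \<Longrightarrow> A i \<in> sets \<mu>"
  shows "{y\<in>{0..1}. \<forall>i<n. (T ^^ i) y \<in> A i} \<in> sets \<mu>"
proof -
  have "{y\<in>space \<mu>. \<forall>i\<in>{..<n}. (T ^^ i) y \<in> A i} \<in> sets \<mu>"
    by (rule sets.sets_Collect_finite_All) (use assms iter_vimage_sets in auto)
  then show ?thesis by (simp add: Ball_def)
qed

lemma cell_sets: "set W \<subseteq> D \<Longrightarrow> cell W \<in> sets \<mu>"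
  unfolding cell_def by (rule itinerary_sets) (use interior_sets nth_mem in blast)

lemma cyl_sets: "set W \<subseteq> D \<Longrightarrow> cyl W \<in> sets \<mu>"
  unfolding cyl_def by (rule itinerary_sets) (use I_sets nth_mem in blast)

lemma cell_unique:
  assumes "set V \<subseteq> D" "set W \<subseteq> D" "y \<in> cell V" "y \<in> cell W" "length V = length W"
  shows "V = W"
proof (rule nth_equalityI[OF assms(5)])
  fix i assume i: "i < length V"
  then have "V ! i \<in> D" "W ! i \<in> D" using assms by auto
  moreover have "(T ^^ i) y \<in> interior (I (V ! i)) \<inter> I (W ! i)"
    using assms i interior_subset by (fastforce simp: cell_def)
  ultimately show "V ! i = W ! i" using interior_disjoint by blast
qed

lemma disjoint_cells: "disjoint_family_on cell (words D k)"
  using cell_unique unfolding disjoint_family_on_def words_def by blast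

text \<open>The two sets differ only at the point 1 and at points whose orbit meets a boundary point
  of an interval.\<close>

lemma measure_cylinder_set:
  assumes W: "set W \<subseteq> D" shows "measure \<mu> (cylinder_set T I W) = measure \<mu> (cell W)"
proof (rule measure_eq_AE)
  have e: "cylinder_set T I W = cyl W - {1}"
    by (auto simp: cylinder_set_def cyl_def has_block_def has_digit_def)
  show "cylinder_set T I W \<in> sets \<mu>"
    unfolding e using null_finite[of "{1}"] cyl_sets[OF W] by auto
  have "AE y in \<mu>. y \<notin> {1}" using null_finite[of "{1}"] by (intro AE_not_in) auto
  then show "AE y in \<mu>. (y \<in> cylinder_set T I W) = (y \<in> cell W)"
    using AE_not_boundary
  proof eventually_elim
    case (elim y)
    have "(T ^^ i) y \<in> I (W ! i) \<longleftrightarrow> (T ^^ i) y \<in> interior (I (W ! i))" if "i < length W" for i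
      using elim(2) W that interior_subset[of "I (W ! i)"] nth_mem by blast
    then show ?case using elim(1) unfolding e by (auto simp: cell_def cyl_def)
  qed
qed (rule cell_sets[OF W])

section \<open>Codes of regular points and shrinking of cells\<close>

definition regular :: "real set" where
  "regular = {y\<in>{0..1}. \<forall>n. \<exists>j\<in>D. (T ^^ n) y \<in> interior (I j)}"

text \<open>For a regular point the chosen index is the only possible one, by disjointness of the
  interiors; for other points the letters may be arbitrary.\<close>

definition code :: "real \<Rightarrow> nat \<Rightarrow> 'd list" where
  "code y k = map (\<lambda>n. SOME j. j \<in> D \<and> (T ^^ n) y \<in> interior (I j)) [0..<k]"

lemma length_code [simp]: "length (code y k) = k"
  by (simp add: code_def)

lemma code:
  assumes "y \<in> regular"
  shows "code y k \<in> words D k" "y \<in> cell (code y k)"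
proof -
  have "(SOME j. j \<in> D \<and> (T ^^ n) y \<in> interior (I j)) \<in> D \<and>
      (T ^^ n) y \<in> interior (I (SOME j. j \<in> D \<and> (T ^^ n) y \<in> interior (I j)))" for n
    using assms by (rule_tac someI_ex) (auto simp: regular_def)
  then show "code y k \<in> words D k" "y \<in> cell (code y k)"
    using assms by (auto simp: words_def code_def cell_def regular_def)
qed

lemma cell_code_antimono: "k \<le> l \<Longrightarrow> cell (code y l) \<subseteq> cell (code y k)"
  by (auto simp: cell_def code_def)

lemma AE_regular: "AE y in \<mu>. y \<in> regular"
  using AE_interior AE_space by eventually_elim (simp add: regular_def)

lemma regular_sets: "regular \<in> sets \<mu>"
proof -
  have "(\<Union>j\<in>D. interior (I j)) \<in> sets \<mu>"
    using interior_sets countable_D by (intro sets.countable_UN') auto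
  then have "{y\<in>space \<mu>. (T ^^ n) y \<in> (\<Union>j\<in>D. interior (I j))} \<in> sets \<mu>" for n
    unfolding space_\<mu> by (rule iter_vimage_sets)
  then have "{y\<in>space \<mu>. \<forall>n. (T ^^ n) y \<in> (\<Union>j\<in>D. interior (I j))} \<in> sets \<mu>"
    by (rule sets.sets_Collect_countable_All)
  then show ?thesis by (simp add: regular_def)
qed

lemma measure_cells: "measure \<mu> (\<Union>W\<in>words D k. cell W) = 1"
proof (subst prob_eq_1)
  show "(\<Union>W\<in>words D k. cell W) \<in> sets \<mu>"
    using cell_sets countable_words by (intro sets.countable_UN') (auto simp: words_def)
  show "AE y in \<mu>. y \<in> (\<Union>W\<in>words D k. cell W)"
    using AE_regular by eventually_elim (use code in blast)
qed

text \<open>Such an interval would be an atom of the \<open>\<sigma>\<close>-algebra generated by the itineraries.\<close>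

lemma no_interval_in_all_cells:
  assumes "a < b" "\<And>k. {a<..<b} \<subseteq> cell (W k)" "\<And>k. W k \<in> words D k"
  shows False
proof -
  let ?Q = "{a<..<b}"
  have Q01: "?Q \<subseteq> {0..1}" using assms(2)[of 0] by (auto simp: cell_def)
  have gen: "?Q \<subseteq> A \<or> ?Q \<inter> A = {}" if "A \<in> generated_sigma T D I" for A
    using that unfolding generated_sigma_def
  proof (rule sigma_sets_subset_or_disjoint[OF _ _ Q01])
    fix A assume "A \<in> (\<Union>n. {(T ^^ n) -` A \<inter> {0..1} |A. A \<in> sigma_sets {0..1} (I ` D)})"
    then obtain n A' where A: "A = (T ^^ n) -` A' \<inter> {0..1}" "A' \<in> sigma_sets {0..1} (I ` D)" by blast
    \<comment> \<open>The image of \<open>?Q\<close> under the \<open>n\<close>-th iterate lies in a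
      single interior, so every interval of the partition contains that image or misses it.\<close>
    let ?v = "W (Suc n) ! n"
    have v: "?v \<in> D" using assms(3)[of "Suc n"] by (auto simp: words_def)
    have Q: "(T ^^ n) ` ?Q \<subseteq> interior (I ?v)"
      using assms(2)[of "Suc n"] assms(3)[of "Suc n"] by (auto simp: cell_def words_def)
    have "(T ^^ n) ` ?Q \<subseteq> A' \<or> (T ^^ n) ` ?Q \<inter> A' = {}"
    proof (rule sigma_sets_subset_or_disjoint[OF A(2)])
      show "(T ^^ n) ` ?Q \<subseteq> B \<or> (T ^^ n) ` ?Q \<inter> B = {}" if B: "B \<in> I ` D" for B
      proof -
        obtain j where j: "j \<in> D" "B = I j" using B by blast
        show ?thesis
          using Q interior_subset[of "I ?v"] interior_disjoint[OF v j(1)] j(2)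
          by (cases "?v = j") blast+
      qed
      show "(T ^^ n) ` ?Q \<subseteq> {0..1}" using iter_in Q01 by blast
    qed
    then show "?Q \<subseteq> A \<or> ?Q \<inter> A = {}" using A(1) Q01 by blast
  qed
  \<comment> \<open>The left half of \<open>?Q\<close> agrees up to a null set with a generated set.
    As this set contains \<open>?Q\<close> or misses it, one of the halves would be null.\<close>
  define c where "c = (a + b) / 2"
  have c: "a < c" "c < b" using assms(1) by (auto simp: c_def)
  have "{a<..<c} \<in> sets unit_borel"
    unfolding unit_borel_def using c Q01
    by (subst sets_restrict_space_iff) (auto simp: subset_eq)
  then obtain A where A: "A \<in> generated_sigma T D I" "sym_diff {a<..<c} A \<in> null_sets unit_lebesgue"
    using F_system unfolding F_system_def equal_mod_def by blast
  have nn: "\<not> {u<..<v} \<subseteq> N" if "u < v" "N \<in> null_sets unit_lebesgue" for u v N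
  proof
    assume s: "{u<..<v} \<subseteq> N"
    have "N \<in> null_sets lborel" using that(2) unfolding unit_lebesgue_def
      by (subst (asm) null_sets_restrict_space) auto
    then have "{u<..<v} \<in> null_sets lborel" by (rule null_sets_subset[OF _ _ s]) auto
    then have "emeasure lborel {u<..<v} = 0" by auto
    then show False using that(1) by simp
  qed
  from gen[OF A(1)] show False
  proof
    assume "?Q \<subseteq> A"
    then have "{c<..<b} \<subseteq> sym_diff {a<..<c} A" using c(1) by (force simp: subset_iff)
    then show False using nn[OF c(2) A(2)] by blast
  next
    assume "?Q \<inter> A = {}"
    then have "{a<..<c} \<subseteq> sym_diff {a<..<c} A" using c(2) by (force simp: disjoint_iff)
    then show False using nn[OF c(1) A(2)] by blast
  qed
qed

text \<open>The cells around \<open>y\<close> are nested intervals. If they did not shrink to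
  \<open>y\<close>, they would all contain \<open>y + d\<close> or all contain \<open>y - d\<close>,
  hence a common open interval.\<close>

lemma cell_code_shrinks:
  assumes y: "y \<in> regular" and d: "d > 0"
  shows "\<exists>k. \<forall>u\<in>cell (code y k). \<bar>u - y\<bar> < d"
proof (rule ccontr)
  assume "\<not> ?thesis"
  then have ex: "\<exists>u\<in>cell (code y k). \<bar>u - y\<bar> \<ge> d" for k by (auto simp: not_less)
  have conv: "w \<in> cell (code y k)" if "u \<in> cell (code y k)" "v \<in> cell (code y k)" "u \<le> w" "w \<le> v" for u v w k
    using code(1)[OF y, of k] cell_ordered[OF _ that] by (auto simp: words_def)
  have alt: "y + d \<in> cell (code y k) \<or> y - d \<in> cell (code y k)" for k
  proof -
    obtain u where u: "u \<in> cell (code y k)" "\<bar>u - y\<bar> \<ge> d" using ex by blast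
    then have "y + d \<le> u \<or> u \<le> y - d" by linarith
    then show ?thesis using u(1) code(2)[OF y] d
        conv[OF code(2)[OF y] u(1), of "y + d"] conv[OF u(1) code(2)[OF y], of "y - d"] by auto
  qed
  have "(\<forall>k. y + d \<in> cell (code y k)) \<or> (\<forall>k. y - d \<in> cell (code y k))"
  proof (rule ccontr)
    assume "\<not> ?thesis"
    then obtain k l where "y + d \<notin> cell (code y k)" "y - d \<notin> cell (code y l)" by blast
    then show False using alt[of "max k l"] cell_code_antimono[of k "max k l" y]
        cell_code_antimono[of l "max k l" y] by auto
  qed
  then show False
  proof
    assume *: "\<forall>k. y + d \<in> cell (code y k)"
    have "{y<..<y + d} \<subseteq> cell (code y k)" for k
      using conv[OF code(2)[OF y] *[rule_format]] by auto
    then show False using no_interval_in_all_cells[of y "y + d" "code y"] d code(1)[OF y] by auto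
  next
    assume *: "\<forall>k. y - d \<in> cell (code y k)"
    have "{y - d<..<y} \<subseteq> cell (code y k)" for k
      using conv[OF *[rule_format] code(2)[OF y]] by auto
    then show False using no_interval_in_all_cells[of "y - d" y "code y"] d code(1)[OF y] by auto
  qed
qed

text \<open>Some regular \<open>y\<close> avoids the countably many null cells. Its cells have
  positive measure and decrease to \<open>{y}\<close>, which is null. A bound from some
  \<open>K\<close> on is stated since only certain word lengths may be available later.\<close>

lemma small_cells:
  assumes "e > 0"
  shows "\<exists>K. \<forall>k\<ge>K. \<exists>W\<in>words D k. 0 < measure \<mu> (cell W) \<and> measure \<mu> (cell W) < e"
proof -
  have "AE y in \<mu>. y \<notin> cell W" if "set W \<subseteq> D" "measure \<mu> (cell W) = 0" for W
    using prob_eq_0[OF cell_sets[OF that(1)]] that(2) by blast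
  then have "AE y in \<mu>. \<forall>W\<in>lists D. measure \<mu> (cell W) = 0 \<longrightarrow> y \<notin> cell W"
    by (subst AE_ball_countable[OF countable_lists[OF countable_D]]) (auto simp: in_lists_conv_set subset_eq)
  then have ae: "AE y in \<mu>. y \<in> regular \<and> (\<forall>W\<in>lists D. measure \<mu> (cell W) = 0 \<longrightarrow> y \<notin> cell W)"
    using AE_regular by eventually_elim blast
  have "\<exists>y. y \<in> regular \<and> (\<forall>W\<in>lists D. measure \<mu> (cell W) = 0 \<longrightarrow> y \<notin> cell W)"
  proof (rule ccontr)
    assume "\<not> ?thesis"
    then have no: "\<not> (y \<in> regular \<and> (\<forall>W\<in>lists D. measure \<mu> (cell W) = 0 \<longrightarrow> y \<notin> cell W))" for y
      by blast
    from ae have "AE y in \<mu>. False" by eventually_elim (use no in blast)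
    then show False by simp
  qed
  then obtain y where y: "y \<in> regular" "\<And>W. W \<in> lists D \<Longrightarrow> measure \<mu> (cell W) = 0 \<Longrightarrow> y \<notin> cell W"
    by blast
  have sub: "set (code y k) \<subseteq> D" for k using code(1)[OF y(1), of k] by (simp add: words_def)
  have pos: "0 < measure \<mu> (cell (code y k))" for k
    using y(2)[of "code y k"] code[OF y(1), of k] zero_less_measure_iff
    by (auto simp: words_def in_lists_conv_set subset_eq)
  have "(\<Inter>k. cell (code y k)) = {y}"
  proof -
    have "u = y" if "u \<in> (\<Inter>k. cell (code y k))" for u
    proof (rule ccontr)
      assume "u \<noteq> y"
      then have "\<bar>u - y\<bar> > 0" by simp
      from cell_code_shrinks[OF y(1) this] show False using that by blast
    qed
    then show ?thesis using code(2)[OF y(1)] by auto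
  qed
  moreover have "(\<lambda>k. measure \<mu> (cell (code y k))) \<longlonglongrightarrow> measure \<mu> (\<Inter>k. cell (code y k))"
    using cell_sets[OF sub] cell_code_antimono
    by (intro finite_Lim_measure_decseq) (auto simp: decseq_def)
  moreover have "measure \<mu> {y} = 0"
    using null_finite[of "{y}"] y(1) measure_eq_0_null_sets by (auto simp: regular_def)
  ultimately have "(\<lambda>k. measure \<mu> (cell (code y k))) \<longlonglongrightarrow> 0" by simp
  from order_tendstoD(2)[OF this assms] obtain K where "\<And>k. k \<ge> K \<Longrightarrow> measure \<mu> (cell (code y k)) < e"
    by (auto simp: eventually_sequentially)
  then show ?thesis using pos code(1)[OF y(1)] by blast
qed

text \<open>By \<open>cell_code_shrinks\<close> every regular point eventually lies in short cells,
  and continuity from below gives a single rank that works up to measure \<open>e\<close>.\<close>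

lemma short_cells:
  assumes d: "d > 0" and e: "e > 0"
  shows "\<exists>k. 1 - e \<le> measure \<mu> (\<Union>W\<in>{W\<in>words D k. \<forall>u\<in>cell W. \<forall>v\<in>cell W. \<bar>u - v\<bar> < d}. cell W)"
proof -
  let ?S = "\<lambda>k. {W\<in>words D k. \<forall>u\<in>cell W. \<forall>v\<in>cell W. \<bar>u - v\<bar> < d}"
  have U: "(\<Union>W\<in>?S k. cell W) \<in> sets \<mu>" for k
  proof (rule sets.countable_UN')
    show "countable (?S k)" by (rule countable_subset[OF _ countable_words[of k]]) blast
  qed (use cell_sets in \<open>auto simp: words_def\<close>)
  \<comment> \<open>Restricting to regular points makes the sets increasing: such a point has cells
    of every rank, while other points may lie in no cell of higher rank.\<close>
  define A where "A = (\<lambda>k. regular \<inter> (\<Union>W\<in>?S k. cell W))"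
  have inA: "y \<in> A k \<longleftrightarrow> (\<forall>u\<in>cell (code y k). \<forall>v\<in>cell (code y k). \<bar>u - v\<bar> < d)" if y: "y \<in> regular" for y k
  proof
    assume "y \<in> A k"
    then obtain W where W: "W \<in> ?S k" "y \<in> cell W" by (auto simp: A_def)
    then have "W = code y k" using code[OF y, of k] cell_unique[of W "code y k" y] by (auto simp: words_def)
    then show "\<forall>u\<in>cell (code y k). \<forall>v\<in>cell (code y k). \<bar>u - v\<bar> < d" using W by auto
  qed (use y code[OF y, of k] in \<open>auto simp: A_def\<close>)
  have "incseq A"
    unfolding incseq_def
  proof (intro allI impI subsetI)
    fix k l :: nat and y assume "k \<le> l" "y \<in> A k"
    moreover then have "y \<in> regular" by (simp add: A_def)
    ultimately show "y \<in> A l" using inA[of y] cell_code_antimono[of k l y] by blast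
  qed
  moreover have "range A \<subseteq> sets \<mu>" unfolding A_def using U regular_sets by blast
  ultimately have "(\<lambda>k. measure \<mu> (A k)) \<longlonglongrightarrow> measure \<mu> (\<Union>k. A k)"
    by (intro finite_Lim_measure_incseq)
  moreover have "(\<Union>k. A k) = regular"
  proof
    show "regular \<subseteq> (\<Union>k. A k)"
    proof
      fix y assume y: "y \<in> regular"
      obtain k where k: "\<And>u. u \<in> cell (code y k) \<Longrightarrow> \<bar>u - y\<bar> < d / 2"
        using cell_code_shrinks[OF y, of "d / 2"] d by auto
      have "\<bar>u - v\<bar> < d" if "u \<in> cell (code y k)" "v \<in> cell (code y k)" for u v
        using k[OF that(1)] k[OF that(2)] by linarith
      then have "y \<in> A k" by (simp add: inA[OF y])
      then show "y \<in> (\<Union>k. A k)" by blast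
    qed
  qed (auto simp: A_def)
  moreover have "measure \<mu> regular = 1" using prob_eq_1[OF regular_sets] AE_regular by simp
  ultimately have "(\<lambda>k. measure \<mu> (A k)) \<longlonglongrightarrow> 1" by simp
  from order_tendstoD(1)[OF this, of "1 - e"] e obtain k where "1 - e < measure \<mu> (A k)"
    by (auto simp: eventually_sequentially)
  also have "\<dots> \<le> measure \<mu> (\<Union>W\<in>?S k. cell W)"
    using U by (intro finite_measure_mono) (auto simp: A_def)
  finally show ?thesis by (intro exI[of _ k]) simp
qed

end

section \<open>Frequencies of cells\<close>

lemma sum_lessThan_add:
  fixes a :: "nat \<Rightarrow> real"
  shows "(\<Sum>n<k + l. a n) = (\<Sum>n<k. a n) + (\<Sum>n<l. a (k + n))"
  by (induction l) (simp_all add: add.assoc)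

lemma sum_lessThan_mult:
  fixes a :: "nat \<Rightarrow> real"
  shows "(\<Sum>n<m * N. a n) = (\<Sum>n<N. \<Sum>i<m. a (m * n + i))"
proof (induction N)
  case (Suc N)
  have "(\<Sum>n<m * Suc N. a n) = (\<Sum>n<m * N + m. a n)" by (simp add: add.commute)
  then show ?case using Suc by (simp only: sum_lessThan_add sum.lessThan_Suc)
qed simp

lemma sum_unit_bounds:
  fixes a :: "'b \<Rightarrow> real"
  assumes "\<And>n. 0 \<le> a n" "\<And>n. a n \<le> 1"
  shows "0 \<le> sum a A" "sum a A \<le> card A"
proof -
  show "0 \<le> sum a A" by (rule sum_nonneg) (rule assms)
  show "sum a A \<le> card A" using sum_bounded_above[of A a 1] assms(2) by simp
qed

lemma sum_shift_bound:
  fixes a :: "nat \<Rightarrow> real"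
  assumes "\<And>n. 0 \<le> a n" "\<And>n. a n \<le> 1"
  shows "\<bar>(\<Sum>n<N. a (i + n)) - (\<Sum>n<N. a n)\<bar> \<le> i"
proof -
  have "(\<Sum>n<i. a n) + (\<Sum>n<N. a (i + n)) = (\<Sum>n<N. a n) + (\<Sum>n<i. a (N + n))"
    using sum_lessThan_add[of a i N] sum_lessThan_add[of a N i] by (simp add: add.commute)
  moreover have "0 \<le> (\<Sum>n<i. a n)" "(\<Sum>n<i. a n) \<le> i"
      "0 \<le> (\<Sum>n<i. a (N + n))" "(\<Sum>n<i. a (N + n)) \<le> i"
    using sum_unit_bounds[of a "{..<i}"] sum_unit_bounds[of "\<lambda>n. a (N + n)" "{..<i}"] assms by auto
  ultimately show ?thesis by linarith
qed

text \<open>The orbit under the \<open>m\<close>-th power keeps the period \<open>p\<close>, because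
  \<open>m * p\<close> is a multiple of \<open>p\<close>. The bound \<open>1 / p\<close> on
  frequencies is therefore independent of \<open>m\<close>.\<close>

lemma funpow_eventually_periodic:
  fixes f :: "'a \<Rightarrow> 'a"
  assumes per: "(f ^^ (i + p)) x = (f ^^ i) x" and m: "m > 0" and n: "n \<ge> i"
  shows "(f ^^ (m * (n + p))) x = (f ^^ (m * n)) x"
proof -
  have 1: "(f ^^ (t + p)) x = (f ^^ t) x" if t: "t \<ge> i" for t
  proof -
    have "(f ^^ (t + p)) x = (f ^^ (t - i)) ((f ^^ (i + p)) x)"
      using t by (simp flip: funpow_add[THEN fun_cong, unfolded comp_def])
    also have "\<dots> = (f ^^ t) x"
      using t unfolding per by (simp flip: funpow_add[THEN fun_cong, unfolded comp_def])
    finally show ?thesis .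
  qed
  have "i \<le> m * n" using m n by (metis le_trans mult_le_mono1 mult_1 Suc_leI One_nat_def)
  then have "(f ^^ (m * n + s * p)) x = (f ^^ (m * n)) x" for s
  proof (induction s)
    case (Suc s)
    have "m * n + Suc s * p = (m * n + s * p) + p" by simp
    then show ?case using 1[of "m * n + s * p"] Suc by (metis trans_le_add1)
  qed simp
  from this[of m] show ?thesis by (simp add: distrib_left)
qed

context f_system
begin

section \<open>Normality as convergence of averages\<close>

abbreviation orbit :: "nat \<Rightarrow> real \<Rightarrow> nat \<Rightarrow> real" where
  "orbit m x \<equiv> (\<lambda>n. (T ^^ (m * n)) x)"

definition cell_frequency :: "nat \<Rightarrow> real \<Rightarrow> 'd list \<Rightarrow> bool" where
  "cell_frequency m x W \<longleftrightarrow> avg (indicator (cell W)) (orbit m x) \<longlonglongrightarrow> measure \<mu> (cell W)"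

text \<open>The limit is the measure of the cell, which is also that of the cylinder by
  \<open>measure_cylinder_set\<close>; thus both frequency notions have the same target.\<close>

definition cyl_frequency :: "nat \<Rightarrow> real \<Rightarrow> 'd list \<Rightarrow> bool" where
  "cyl_frequency m x W \<longleftrightarrow> avg (indicator (cyl W)) (orbit m x) \<longlonglongrightarrow> measure \<mu> (cell W)"

lemma avg_cyl_eq:
  assumes "x \<in> {0..1}"
  shows "real (card {n\<in>{1..N}. has_block T I x (m * (n - 1) + 1) S}) / real N
    = avg (indicator (cyl S)) (orbit m x) N"
proof -
  have "has_block T I x (m * k + 1) S \<longleftrightarrow> orbit m x k \<in> cyl S" for k
  proof -
    have "(T ^^ (m * k + i)) x = (T ^^ i) ((T ^^ (m * k)) x)" for i
      by (simp add: add.commute[of _ i] funpow_add)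
    then show ?thesis using iter_in[OF assms, of "m * k"]
      by (simp add: has_block_def has_digit_def cyl_def)
  qed
  note block = this
  have "real (card {n\<in>{1..N}. has_block T I x (m * (n - 1) + 1) S})
      = (\<Sum>n\<in>{n\<in>{1..N}. has_block T I x (m * (n - 1) + 1) S}. 1)" by simp
  also have "\<dots> = (\<Sum>n\<in>{1..N}. if has_block T I x (m * (n - 1) + 1) S then 1 else 0)"
    by (rule sum.inter_filter) simp
  also have "\<dots> = (\<Sum>n<N. if has_block T I x (m * n + 1) S then 1 else 0)"
    unfolding One_nat_def sum.atLeast1_atMost_eq by simp
  also have "\<dots> = (\<Sum>n<N. indicator (cyl S) (orbit m x n))"
    unfolding block by (rule sum.cong) (auto simp: indicator_def)
  finally show ?thesis by (simp add: avg_def)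
qed

lemma measure_cylinder_set_words:
  "W \<in> words D k \<Longrightarrow> measure \<mu> (cylinder_set T I W) = measure \<mu> (cell W)"
  by (simp add: words_def measure_cylinder_set)

lemma simply_power_normal_iff:
  assumes "x \<in> {0..1}"
  shows "simply_power_normal_point T \<mu> D I m x \<longleftrightarrow> (\<forall>W\<in>words D m. cyl_frequency m x W)"
  unfolding simply_power_normal_point_def avg_cyl_eq[OF assms] cyl_frequency_def
  by (intro ball_cong refl) (simp only: measure_cylinder_set_words)

lemma power_normal_iff:
  assumes "x \<in> {0..1}"
  shows "power_normal_point T \<mu> D I m x \<longleftrightarrow> (\<forall>p\<ge>1. \<forall>W\<in>words D (m * p). cyl_frequency m x W)"
  unfolding power_normal_point_def avg_cyl_eq[OF assms] cyl_frequency_def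
  by (intro all_cong ball_cong refl) (simp only: measure_cylinder_set_words)

lemma normal_iff:
  assumes "x \<in> {0..1}"
  shows "normal_point T \<mu> D I x \<longleftrightarrow> (\<forall>k\<ge>1. \<forall>W\<in>words D k. cyl_frequency 1 x W)"
proof -
  have "{n\<in>{1..N}. has_block T I x n S} = {n\<in>{1..N}. has_block T I x (1 * (n - 1) + 1) S}" for N S
    by auto
  then have "normal_point T \<mu> D I x \<longleftrightarrow> power_normal_point T \<mu> D I 1 x"
    unfolding normal_point_def power_normal_point_def by (simp only: mult_1)
  then show ?thesis by (simp add: power_normal_iff[OF assms])
qed

text \<open>An orbit with a repetition is eventually periodic, so positive limit frequencies are at
  least \<open>1 / p\<close>, whereas \<open>small_cells\<close> supplies smaller positive measures.
  Cylinders appear here because exchanging them for cells requires injectivity.\<close>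

lemma inj_orbit_if_cyl_frequency:
  assumes "\<And>K. \<exists>m>0. \<exists>k\<ge>K. \<forall>W\<in>words D k. cyl_frequency m x W"
  shows "inj (\<lambda>n. (T ^^ n) x)"
proof (rule ccontr)
  assume "\<not> ?thesis"
  then obtain i p where p: "p > 0" "(T ^^ (i + p)) x = (T ^^ i) x"
    unfolding inj_def by (metis less_imp_add_positive linorder_neqE_nat)
  obtain K where K: "\<And>k. k \<ge> K \<Longrightarrow> \<exists>W\<in>words D k. 0 < measure \<mu> (cell W) \<and> measure \<mu> (cell W) < 1 / p"
    using small_cells[of "1 / p"] p(1) by auto
  obtain m k where m: "m > 0" "k \<ge> K" "\<And>W. W \<in> words D k \<Longrightarrow> cyl_frequency m x W"
    using assms by blast
  obtain W where W: "W \<in> words D k" "0 < measure \<mu> (cell W)" "measure \<mu> (cell W) < 1 / p"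
    using K[OF m(2)] by blast
  have "1 / p \<le> measure \<mu> (cell W)"
    using avg_eventually_periodic[of p i "orbit m x", OF p(1) _ m(3)[OF W(1), unfolded cyl_frequency_def] W(2)]
      funpow_eventually_periodic[OF p(2) m(1)] by blast
  then show False using W(3) by simp
qed

text \<open>The indicators differ only when one of finitely many iterates hits one of finitely many
  boundary points, which happens finitely often along an injective orbit.\<close>

lemma cell_frequency_iff_cyl:
  assumes inj: "inj (\<lambda>n. (T ^^ n) x)" and x: "x \<in> {0..1}" and m: "m > 0" and W: "set W \<subseteq> D"
  shows "cell_frequency m x W \<longleftrightarrow> cyl_frequency m x W"
proof -
  let ?X = "{n. indicator (cell W) (orbit m x n) \<noteq> (indicator (cyl W) (orbit m x n) :: real)}"
  have "?X \<subseteq> (\<Union>i<length W. (\<lambda>n. (T ^^ (i + m * n)) x) -` (I (W ! i) - interior (I (W ! i))))"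
    using interior_subset by (auto simp: indicator_def cell_def cyl_def funpow_add split: if_splits)
  moreover have "finite \<dots>"
  proof (intro finite_UN_I finite_vimageI)
    fix i assume "i \<in> {..<length W}"
    then show "finite (I (W ! i) - interior (I (W ! i)))" using W by (auto intro!: finite_boundary)
    show "inj (\<lambda>n. (T ^^ (i + m * n)) x)"
    proof (rule injI)
      fix a b assume "(T ^^ (i + m * a)) x = (T ^^ (i + m * b)) x"
      from injD[OF inj this] show "a = b" using m by simp
    qed
  qed simp
  ultimately have X: "finite ?X" by (rule finite_subset)
  then have X': "finite {n. indicator (cyl W) (orbit m x n) \<noteq> (indicator (cell W) (orbit m x n) :: real)}"
    by (simp add: eq_commute)
  then show ?thesis unfolding cell_frequency_def cyl_frequency_def
    using avg_cong_cofinite[where z = "orbit m x" and f = "indicator (cell W)", OF X]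
      avg_cong_cofinite[where z = "orbit m x" and f = "indicator (cyl W)", OF X'] by blast
qed

section \<open>From block frequencies to word frequencies\<close>

lemma cell_take_drop:
  assumes W: "W \<in> words D l" and S: "set S \<subseteq> D" and y: "y \<in> cell W" and i: "i + length S \<le> l"
  shows "(T ^^ i) y \<in> cell S \<longleftrightarrow> take (length S) (drop i W) = S"
proof -
  let ?V = "take (length S) (drop i W)"
  have l: "length ?V = length S" using W i by (simp add: words_def)
  have "(T ^^ i) y \<in> cell ?V"
    using y W i iter_in[of y i] unfolding cell_def words_def
    by (auto simp: funpow_add[THEN fun_cong, unfolded comp_def, symmetric] add.commute)
  moreover have "set ?V \<subseteq> D" using W by (auto simp: words_def dest!: in_set_takeD in_set_dropD)
  ultimately show ?thesis using cell_unique[OF _ S _ _ l] by metis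
qed

lemma integral_cell_iter:
  assumes "set S \<subseteq> D"
  shows "(\<integral>y. indicator (cell S) ((T ^^ i) y) \<partial>\<mu>) = measure \<mu> (cell S)"
    "integrable \<mu> (\<lambda>y. indicator (cell S) ((T ^^ i) y) :: real)"
proof -
  interpret R: measure_preserving \<mu> "T ^^ i" by (rule measure_preserving_iter)
  have s: "cell S \<in> sets \<mu>" by (rule cell_sets[OF assms])
  have "integrable \<mu> (indicator (cell S) :: real \<Rightarrow> real)"
    using s by (simp add: emeasure_eq_measure)
  then show "integrable \<mu> (\<lambda>y. indicator (cell S) ((T ^^ i) y) :: real)"
    by (rule R.integrable_compose)
  show "(\<integral>y. indicator (cell S) ((T ^^ i) y) \<partial>\<mu>) = measure \<mu> (cell S)"
    using s sets.sets_into_space[OF s] by (subst R.integral_compose) (auto simp: Int_absorb2)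
qed

lemma avg_cells_tendsto:
  assumes x: "x \<in> {0..1}" and f: "f \<in> borel_measurable \<mu>" "\<And>y. y \<in> {0..1} \<Longrightarrow> \<bar>f y\<bar> \<le> B"
    and freq: "\<And>W. W \<in> words D k \<Longrightarrow> cell_frequency m x W"
    and h: "\<And>W y. W \<in> words D k \<Longrightarrow> y \<in> cell W \<Longrightarrow> f y = h W"
  shows "avg f (orbit m x) \<longlonglongrightarrow> (\<integral>y. f y \<partial>\<mu>)"
proof (rule avg_tendsto_cells[where W = "words D k" and E = cell and B = B and h = h])
  show "\<And>n. orbit m x n \<in> space \<mu>" using iter_in[OF x] by simp
qed (use countable_words cell_sets disjoint_cells measure_cells f freq h in
    \<open>auto simp: words_def cell_frequency_def\<close>)

text \<open>Occurrences of \<open>S\<close> lying inside a block of length \<open>m\<close> are a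
  function of that block, so their averages converge; the remaining starting positions have density
  \<open>k / m\<close>, which is made small.\<close>

lemma cell_frequency_if_simply_normal:
  assumes x: "x \<in> {0..1}" and S: "set S \<subseteq> D"
    and ex: "\<And>K. \<exists>m\<ge>K. \<forall>W\<in>words D m. cell_frequency m x W"
  shows "cell_frequency 1 x S"
proof -
  define c k a where "c = measure \<mu> (cell S)" and "k = length S"
    and "a = (\<lambda>n. indicator (cell S) ((T ^^ n) x) :: real)"
  have a: "0 \<le> a n" "a n \<le> 1" for n by (auto simp: a_def indicator_def)
  have "(\<lambda>N. (\<Sum>n<N. a n) / N) \<longlonglongrightarrow> c"
  proof (rule tendstoI)
    fix e :: real assume e: "e > 0"
    \<comment> \<open>With \<open>m \<ge> K\<close> the neglected proportion \<open>k / m\<close> is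
      at most \<open>e / 12\<close>; three such errors add up to \<open>e / 4\<close>, which
      \<open>average_from_blocks\<close> doubles to \<open>e / 2\<close>.\<close>
    obtain K :: nat where K: "K > 12 * k / e" using reals_Archimedean2 by blast
    obtain m where m: "m \<ge> max (k + 1) K" and freq: "\<And>W. W \<in> words D m \<Longrightarrow> cell_frequency m x W"
      using ex by metis
    have m0: "m > 0" "k \<le> m" using m by auto
    have "real m > 12 * k / e" using K m by linarith
    then have km: "k / m \<le> e / 12" using e m0 by (simp add: field_simps)
    \<comment> \<open>The count starts at the first \<open>m - k\<close> positions only, so each
      occurrence fits in the block and \<open>f\<close> is constant on cells of rank
      \<open>m\<close>. The division is by \<open>m\<close>, the full block length.\<close>
    define f where "f = (\<lambda>y. (\<Sum>i<m - k. indicator (cell S) ((T ^^ i) y)) / m :: real)"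
    have fb: "\<bar>f y\<bar> \<le> 1" for y
    proof -
      have "0 \<le> (\<Sum>i<m - k. indicator (cell S) ((T ^^ i) y) :: real)" by (simp add: sum_nonneg)
      moreover have "(\<Sum>i<m - k. indicator (cell S) ((T ^^ i) y) :: real) \<le> m - k"
        using sum_unit_bounds(2)[of "\<lambda>i. indicator (cell S) ((T ^^ i) y)" "{..<m - k}"] by simp
      ultimately show ?thesis using m0 by (simp add: f_def)
    qed
    have lim: "avg f (orbit m x) \<longlonglongrightarrow> (\<integral>y. f y \<partial>\<mu>)"
    proof (rule avg_cells_tendsto[OF x _ fb freq])
      show "f \<in> borel_measurable \<mu>"
        unfolding f_def using integral_cell_iter(2)[OF S] by (intro borel_measurable_divide borel_measurable_sum) auto
      show "f y = (\<Sum>i<m - k. of_bool (take k (drop i W) = S)) / m" if "W \<in> words D m" "y \<in> cell W" for W y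
        unfolding f_def using cell_take_drop[OF that(1) S that(2)]
        by (intro arg_cong2[where f = "(/)"] sum.cong) (auto simp: indicator_def k_def)
    qed
    have "(\<integral>y. f y \<partial>\<mu>) = (m - k) / m * c"
      unfolding f_def using integral_cell_iter[OF S] by (simp add: Bochner_Integration.integral_sum c_def)
    moreover have "(m - k) / m * c = c - k / m * c"
      using m0 by (simp add: field_simps of_nat_diff)
    moreover have "k / m * c \<le> k / m" "0 \<le> k / m * c"
      using mult_left_le[of c "k / m"] by (simp_all add: c_def)
    ultimately have fc: "\<bar>(\<integral>y. f y \<partial>\<mu>) - c\<bar> \<le> e / 12" using km by linarith
    have "\<forall>\<^sub>F N in sequentially. \<bar>avg f (orbit m x) N - (\<integral>y. f y \<partial>\<mu>)\<bar> < e / 12"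
      using tendstoD[OF lim, of "e / 12"] e by (simp add: dist_real_def)
    then have "\<forall>\<^sub>F N in sequentially. \<bar>(\<Sum>n<m * N. a n) / real (m * N) - c\<bar> \<le> e / 4"
      using eventually_gt_at_top[of 0]
    proof eventually_elim
      case (elim N)
      have "(\<Sum>i<m. a (m * n + i)) = m * f (orbit m x n) + (\<Sum>i<k. a (m * n + (m - k + i)))" for n
      proof -
        have "(\<Sum>i<m. a (m * n + i)) = (\<Sum>i<m - k. a (m * n + i)) + (\<Sum>i<k. a (m * n + (m - k + i)))"
          using sum_lessThan_add[of "\<lambda>i. a (m * n + i)" "m - k" k] m0 by simp
        moreover have "a (m * n + i) = indicator (cell S) ((T ^^ i) (orbit m x n))" for i
          by (simp add: a_def add.commute[of _ i] funpow_add)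
        ultimately show ?thesis using m0 by (simp add: f_def)
      qed
      then have "(\<Sum>n<m * N. a n) = m * (\<Sum>n<N. f (orbit m x n)) + (\<Sum>n<N. \<Sum>i<k. a (m * n + (m - k + i)))"
        by (simp add: sum_lessThan_mult sum.distrib sum_distrib_left)
      moreover have "0 \<le> (\<Sum>n<N. \<Sum>i<k. a (m * n + (m - k + i)))" using a by (intro sum_nonneg)
      moreover have "(\<Sum>n<N. \<Sum>i<k. a (m * n + (m - k + i))) \<le> N * k"
      proof -
        have "(\<Sum>i<k. a (m * n + (m - k + i))) \<le> k" for n
          using sum_unit_bounds(2)[of "\<lambda>i. a (m * n + (m - k + i))" "{..<k}"] a by simp
        then show ?thesis
          using sum_bounded_above[of "{..<N}" "\<lambda>n. \<Sum>i<k. a (m * n + (m - k + i))" "real k"] by simp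
      qed
      ultimately have Q: "0 \<le> (\<Sum>n<m * N. a n) - m * (\<Sum>n<N. f (orbit m x n))"
        "(\<Sum>n<m * N. a n) - m * (\<Sum>n<N. f (orbit m x n)) \<le> N * k" by auto
      moreover have "(\<Sum>n<m * N. a n) / real (m * N) - avg f (orbit m x) N
          = ((\<Sum>n<m * N. a n) - m * (\<Sum>n<N. f (orbit m x n))) / (m * N)"
        using m0 elim(2) by (simp add: avg_def field_simps)
      ultimately have "0 \<le> (\<Sum>n<m * N. a n) / real (m * N) - avg f (orbit m x) N"
        "(\<Sum>n<m * N. a n) / real (m * N) - avg f (orbit m x) N \<le> N * k / (m * N)"
        using divide_right_mono[OF Q(1), of "real (m * N)"] divide_right_mono[OF Q(2), of "real (m * N)"]
        by simp_all
      moreover have "real (N * k) / real (m * N) = k / m" using elim(2) by simp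
      moreover define q where "q = (\<Sum>n<m * N. a n) / real (m * N)"
      ultimately have "0 \<le> q - avg f (orbit m x) N" "q - avg f (orbit m x) N \<le> k / m"
        unfolding q_def by simp_all
      \<comment> \<open>The three errors of size \<open>e / 12\<close> are the last \<open>k\<close>
        positions of each block, the average of \<open>f\<close> against its integral, and that
        integral against \<open>c\<close>.\<close>
      then have "\<bar>q - c\<bar> \<le> e / 4" using km fc elim(1) by linarith
      then show ?case by (simp only: q_def)
    qed
    from average_from_blocks[OF a m0(1) _ this] e
    have "\<forall>\<^sub>F N in sequentially. \<bar>(\<Sum>n<N. a n) / real N - c\<bar> \<le> e / 2" by simp
    then show "\<forall>\<^sub>F N in sequentially. dist ((\<Sum>n<N. a n) / real N) c < e"
      by eventually_elim (use e in \<open>simp add: dist_real_def\<close>)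
  qed
  then show ?thesis by (simp add: cell_frequency_def avg_def[abs_def] a_def c_def)
qed

section \<open>From all positions to multiples of m\<close>

lemma cell_frequency_Nil:
  assumes "x \<in> {0..1}" shows "cell_frequency m x []"
proof -
  have "\<forall>\<^sub>F N in sequentially. avg (indicator (cell [])) (orbit m x) N = measure \<mu> (cell [])"
    using eventually_gt_at_top[of 0]
  proof eventually_elim
    case (elim N)
    have "cell [] = {0..1}" by (auto simp: cell_def)
    then show ?case using elim iter_in[OF assms] prob_space by (simp add: avg_def)
  qed
  then show ?thesis unfolding cell_frequency_def by (rule tendsto_eventually)
qed

lemma cell_frequency_shift:
  assumes "cell_frequency 1 x S" shows "cell_frequency 1 ((T ^^ k) x) S"
proof -
  define a where "a = (\<lambda>n. indicator (cell S) ((T ^^ n) x) :: real)"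
  have "avg (indicator (cell S)) (orbit 1 ((T ^^ k) x)) = (\<lambda>N.
      avg (indicator (cell S)) (orbit 1 x) N + ((\<Sum>n<N. a (k + n)) - (\<Sum>n<N. a n)) / N)"
    by (rule ext) (simp add: avg_def a_def add.commute[of k] funpow_add diff_divide_distrib)
  moreover have "(\<lambda>N. ((\<Sum>n<N. a (k + n)) - (\<Sum>n<N. a n)) / N) \<longlonglongrightarrow> 0"
  proof (rule tendsto_0_le[where K = 1, OF lim_const_over_n[of "real k"]], intro always_eventually allI)
    fix N
    have "\<bar>(\<Sum>n<N. a (k + n)) - (\<Sum>n<N. a n)\<bar> \<le> k"
      by (rule sum_shift_bound) (auto simp: a_def indicator_def)
    then show "norm (((\<Sum>n<N. a (k + n)) - (\<Sum>n<N. a n)) / real N) \<le> norm (real k / real N) * 1"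
      by (simp add: divide_right_mono)
  qed
  ultimately show ?thesis
    using tendsto_add[OF assms[unfolded cell_frequency_def],
        of "\<lambda>N. ((\<Sum>n<N. a (k + n)) - (\<Sum>n<N. a n)) / N" 0]
    unfolding cell_frequency_def by (simp only: add_0_right)
qed

text \<open>Total ergodicity makes the Birkhoff averages of the \<open>m\<close>-th power close to
  \<open>c\<close> in mean. Their distance to \<open>c\<close> is nonnegative, so its average over
  every \<open>m\<close>-th time is at most \<open>m\<close> times its average over all
  times.\<close>

lemma cell_frequency_power:
  assumes te: "totally_ergodic_map \<mu> T" and x: "x \<in> {0..1}" and m: "m > 0" and S: "set S \<subseteq> D"
    and freq: "\<And>W. set W \<subseteq> D \<Longrightarrow> cell_frequency 1 x W"
  shows "cell_frequency m x S"
proof -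
  interpret R: measure_preserving \<mu> "T ^^ m" by (rule measure_preserving_iter)
  have erg: "ergodic_map \<mu> (T ^^ m)" using te m by (auto simp: totally_ergodic_map_def)
  define f where "f = (indicator (cell S) :: real \<Rightarrow> real)"
  define c where "c = measure \<mu> (cell S)"
  have f: "0 \<le> f y" "f y \<le> 1" for y by (auto simp: f_def indicator_def)
  have fm: "f \<in> borel_measurable \<mu>" unfolding f_def using cell_sets[OF S] by simp
  have fi: "(\<integral>y. f y \<partial>\<mu>) = c" using integral_cell_iter(1)[OF S, of 0] by (simp add: f_def c_def)
  have "avg f (orbit m x) \<longlonglongrightarrow> c"
  proof (rule tendstoI)
    fix e :: real assume e: "e > 0"
    have "(\<lambda>L. \<integral>y. \<bar>birkhoff_sum (T ^^ m) f L y / L - c\<bar> \<partial>\<mu>) \<longlonglongrightarrow> 0"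
      using R.mean_ergodic[OF erg fm, of 1] f unfolding fi by simp
    \<comment> \<open>The factor \<open>1 / m\<close> pays for passing from all times to multiples
      of \<open>m\<close>.\<close>
    then have "\<forall>\<^sub>F L in sequentially. (\<integral>y. \<bar>birkhoff_sum (T ^^ m) f L y / L - c\<bar> \<partial>\<mu>) < e / (4 * m)"
      using e m by (intro order_tendstoD) auto
    from eventually_happens'[OF _ eventually_conj[OF this eventually_gt_at_top[of 0]]]
    obtain L :: nat where L: "(\<integral>y. \<bar>birkhoff_sum (T ^^ m) f L y / L - c\<bar> \<partial>\<mu>) < e / (4 * m)" "L > 0"
      by auto
    define h where "h = (\<lambda>y. \<bar>birkhoff_sum (T ^^ m) f L y / L - c\<bar>)"
    have h1: "\<bar>h y\<bar> \<le> 1" for y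
    proof -
      have "0 \<le> birkhoff_sum (T ^^ m) f L y" "birkhoff_sum (T ^^ m) f L y \<le> L"
        unfolding birkhoff_sum_def
        using sum_unit_bounds[of "\<lambda>i. f (((T ^^ m) ^^ i) y)" "{..<L}"] f by auto
      then have "0 \<le> birkhoff_sum (T ^^ m) f L y / L" "birkhoff_sum (T ^^ m) f L y / L \<le> 1"
        using L(2) by auto
      moreover have "0 \<le> c" "c \<le> 1" by (auto simp: c_def)
      ultimately show ?thesis unfolding h_def by linarith
    qed
    have hm: "h \<in> borel_measurable \<mu>" unfolding h_def using R.measurable_birkhoff_sum[OF fm] by measurable
    \<comment> \<open>This many digits determine \<open>h\<close>: the last copy of \<open>S\<close>
      tested begins at position \<open>m * (L - 1)\<close>.\<close>
    let ?K = "m * L + length S"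
    have lim: "avg h (orbit 1 x) \<longlonglongrightarrow> (\<integral>y. h y \<partial>\<mu>)"
    proof (rule avg_cells_tendsto[OF x hm h1])
      show "cell_frequency 1 x W" if "W \<in> words D ?K" for W using that freq by (simp add: words_def)
      show "h y = \<bar>(\<Sum>i<L. of_bool (take (length S) (drop (m * i) W) = S)) / L - c\<bar>"
        if W: "W \<in> words D ?K" and y: "y \<in> cell W" for W y
      proof -
        have "f (((T ^^ m) ^^ i) y) = of_bool (take (length S) (drop (m * i) W) = S)" if "i < L" for i
          using cell_take_drop[OF W S y, of "m * i"] that by (simp add: f_def indicator_def funpow_mult)
        then show ?thesis by (simp add: h_def birkhoff_sum_def)
      qed
    qed
    have "\<forall>\<^sub>F N in sequentially. avg h (orbit 1 x) N < e / (4 * m)"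
      using order_tendstoD(2)[OF lim] L(1) by (simp add: h_def)
    moreover have "filterlim (\<lambda>N. m * N) sequentially sequentially"
      using m by (intro filterlim_subseq) (auto simp: strict_mono_def)
    ultimately have "\<forall>\<^sub>F N in sequentially. avg h (orbit 1 x) (m * N) < e / (4 * m)"
      unfolding filterlim_iff by blast
    moreover have "\<forall>\<^sub>F N in sequentially. L / real N < e / 2"
      using order_tendstoD(2)[OF lim_const_over_n[of "real L"], of "e / 2"] e by simp
    ultimately show "\<forall>\<^sub>F N in sequentially. dist (avg f (orbit m x) N) c < e"
      using eventually_gt_at_top[of 0]
    proof eventually_elim
      case (elim N)
      have "(\<Sum>n<N. h (orbit m x n)) \<le> (\<Sum>n<N. \<Sum>i<m. h ((T ^^ (m * n + i)) x))"
      proof (rule sum_mono)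
        fix n
        show "h (orbit m x n) \<le> (\<Sum>i<m. h ((T ^^ (m * n + i)) x))"
          using member_le_sum[of 0 "{..<m}" "\<lambda>i. h ((T ^^ (m * n + i)) x)"] m by (simp add: h_def)
      qed
      also have "\<dots> = (\<Sum>n<m * N. h ((T ^^ n) x))" by (rule sum_lessThan_mult[symmetric])
      also have "\<dots> = avg h (orbit 1 x) (m * N) * (m * N)" using m elim(3) by (simp add: avg_def)
      also have "\<dots> \<le> e / (4 * m) * (m * N)" using elim(1) by (intro mult_right_mono) auto
      also have "\<dots> = e / 4 * N" using m by simp
      finally have 1: "avg h (orbit m x) N \<le> e / 4" using elim(3) by (simp add: avg_def field_simps)
      have "\<bar>avg (\<lambda>y. birkhoff_sum (T ^^ m) f L y / L) (orbit m x) N - c\<bar>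
          = \<bar>avg (\<lambda>y. birkhoff_sum (T ^^ m) f L y / L - c) (orbit m x) N\<bar>"
        using elim(3) by (simp add: avg_diff avg_const)
      also have "\<dots> \<le> avg h (orbit m x) N" unfolding h_def by (rule abs_avg_le)
      finally have 2: "\<bar>avg (\<lambda>y. birkhoff_sum (T ^^ m) f L y / L) (orbit m x) N - c\<bar> \<le> e / 4" using 1 by simp
      let ?a = "\<lambda>n. f (orbit m x n)"
      \<comment> \<open>Averaging the Birkhoff averages along the orbit changes the plain average by
        at most \<open>L / N\<close>: each of the \<open>L\<close> shifted sums differs from the
        unshifted one by at most \<open>L\<close>, and the total is divided by
        \<open>L * N\<close>.\<close>
      have "birkhoff_sum (T ^^ m) f L (orbit m x n) = (\<Sum>i<L. ?a (i + n))" for n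
        by (simp add: birkhoff_sum_def funpow_mult distrib_left funpow_add)
      then have "(\<Sum>n<N. birkhoff_sum (T ^^ m) f L (orbit m x n)) - L * (\<Sum>n<N. ?a n)
          = (\<Sum>i<L. (\<Sum>n<N. ?a (i + n)) - (\<Sum>n<N. ?a n))"
        by (simp add: sum_subtractf sum.swap[of _ "{..<L}"])
      also have "\<bar>\<dots>\<bar> \<le> (\<Sum>i<L. \<bar>(\<Sum>n<N. ?a (i + n)) - (\<Sum>n<N. ?a n)\<bar>)" by (rule sum_abs)
      also have "\<dots> \<le> (\<Sum>i<L. real L)"
      proof (rule sum_mono)
        fix i assume "i \<in> {..<L}"
        then show "\<bar>(\<Sum>n<N. ?a (i + n)) - (\<Sum>n<N. ?a n)\<bar> \<le> real L"
          using sum_shift_bound[of ?a i N] f by simp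
      qed
      finally have "\<bar>(\<Sum>n<N. birkhoff_sum (T ^^ m) f L (orbit m x n)) - L * (\<Sum>n<N. ?a n)\<bar> \<le> L * L" by simp
      then have "\<bar>(\<Sum>n<N. birkhoff_sum (T ^^ m) f L (orbit m x n)) - L * (\<Sum>n<N. ?a n)\<bar> / (L * N) \<le> L * L / (L * N)"
        by (intro divide_right_mono) auto
      moreover have "\<bar>avg (\<lambda>y. birkhoff_sum (T ^^ m) f L y / L) (orbit m x) N - avg f (orbit m x) N\<bar>
        = \<bar>(\<Sum>n<N. birkhoff_sum (T ^^ m) f L (orbit m x n)) - L * (\<Sum>n<N. ?a n)\<bar> / (L * N)"
      proof -
        have "avg (\<lambda>y. birkhoff_sum (T ^^ m) f L y / L) (orbit m x) N - avg f (orbit m x) N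
          = ((\<Sum>n<N. birkhoff_sum (T ^^ m) f L (orbit m x n)) - L * (\<Sum>n<N. ?a n)) / (L * N)"
          using L(2) elim(3) by (simp add: avg_def field_simps sum_divide_distrib[symmetric])
        then show ?thesis by (simp add: abs_divide)
      qed
      ultimately have "\<bar>avg (\<lambda>y. birkhoff_sum (T ^^ m) f L y / L) (orbit m x) N - avg f (orbit m x) N\<bar> \<le> L / N"
        using L(2) by simp
      then show ?case using 2 elim(2) e unfolding dist_real_def by linarith
    qed
  qed
  then show ?thesis by (simp add: cell_frequency_def f_def c_def)
qed

end

section \<open>Equidistribution\<close>

context f_system
begin

text \<open>A continuous function varies by less than \<open>e\<close> on cells shorter than the
  \<open>d\<close> of uniform continuity, and finitely many such cells cover all but measure
  \<open>e\<close>.\<close>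

lemma equidistributed_if_cell_frequency:
  assumes x: "x \<in> {0..1}" and freq: "\<And>W. set W \<subseteq> D \<Longrightarrow> cell_frequency 1 x W"
  shows "equidistributed_orbit T \<mu> x"
  unfolding equidistributed_orbit_def
proof (intro allI impI)
  fix f :: "real \<Rightarrow> real" assume f: "continuous_on {0..1} f"
  have "bounded (f ` {0..1})" by (intro compact_imp_bounded compact_continuous_image f) simp
  then obtain B where B: "\<And>y. y \<in> {0..1} \<Longrightarrow> \<bar>f y\<bar> \<le> B"
    unfolding bounded_iff by (metis imageI real_norm_def)
  have B0: "B \<ge> 0" using B[OF x] by linarith
  have fm: "f \<in> borel_measurable \<mu>"
    using borel_measurable_continuous_on_restrict[OF f] measurable_cong_sets[OF sets_\<mu> refl] by blast
  have uc: "uniformly_continuous_on {0..1} f" by (rule compact_uniformly_continuous[OF f]) simp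
  have "avg f (orbit 1 x) \<longlonglongrightarrow> (\<integral>y. f y \<partial>\<mu>)"
  proof (rule tendstoI)
    fix r :: real assume r: "r > 0"
    define e where "e = r / (6 * (1 + B))"
    have "3 * (1 + B) * e = r / 2" using B0 by (simp add: e_def field_simps)
    then have e: "e > 0" "3 * (1 + B) * e < r" using r B0 by (auto simp: e_def)
    obtain d where d: "d > 0" "\<And>u v. u \<in> {0..1} \<Longrightarrow> v \<in> {0..1} \<Longrightarrow> \<bar>v - u\<bar> < d \<Longrightarrow> \<bar>f v - f u\<bar> < e"
      using uc e(1) unfolding uniformly_continuous_on_def dist_real_def by metis
    \<comment> \<open>One \<open>e / 2\<close> is for the long cells, the other for the passage to
      finitely many short cells.\<close>
    obtain k where k: "1 - e / 2 \<le> measure \<mu> (\<Union>W\<in>{W\<in>words D k. \<forall>u\<in>cell W. \<forall>v\<in>cell W. \<bar>u - v\<bar> < d}. cell W)"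
      using short_cells[OF d(1), of "e / 2"] e(1) by auto
    let ?F = "{W\<in>words D k. \<forall>u\<in>cell W. \<forall>v\<in>cell W. \<bar>u - v\<bar> < d}"
    have "countable ?F" by (rule countable_subset[OF _ countable_words[of k]]) blast
    then obtain F where F: "finite F" "F \<subseteq> ?F"
        "measure \<mu> (\<Union>W\<in>?F. cell W) - e / 2 \<le> measure \<mu> (\<Union>W\<in>F. cell W)"
      using finite_subcover_up_to[of ?F cell _ "e / 2"] cell_sets e(1)
      by (auto simp: words_def)
    have FD: "set W \<subseteq> D" if "W \<in> F" for W using that F(2) by (auto simp: words_def)
    have "\<forall>\<^sub>F N in sequentially. \<bar>avg f (orbit 1 x) N - (\<integral>y. f y \<partial>\<mu>)\<bar> \<le> 3 * (1 + B) * e"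
    \<comment> \<open>The step function takes the value of \<open>f\<close> at a chosen point of the
      cell; for an empty cell the choice is arbitrary and the oscillation condition is
      vacuous.\<close>
    proof (rule avg_close[where E = cell and h = "\<lambda>W. f (SOME y. y \<in> cell W)", OF F(1) _ _ _ fm])
      show "cell W \<in> sets \<mu>" if "W \<in> F" for W by (rule cell_sets[OF FD[OF that]])
      show "disjoint_family_on cell F"
        using disjoint_cells[of k] F(2) unfolding disjoint_family_on_def by blast
      show "1 - e \<le> measure \<mu> (\<Union>W\<in>F. cell W)" using k F(3) by linarith
      show "(\<lambda>N. avg (indicator (cell W)) (orbit 1 x) N) \<longlonglongrightarrow> measure \<mu> (cell W)" if "W \<in> F" for W
        using freq[OF FD[OF that]] unfolding cell_frequency_def .
      show "\<bar>f y - f (SOME y. y \<in> cell W)\<bar> \<le> e" if W: "W \<in> F" and y: "y \<in> cell W" for W y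
      proof -
        have s: "(SOME y. y \<in> cell W) \<in> cell W" using y by (rule someI)
        have "\<bar>y - (SOME y. y \<in> cell W)\<bar> < d" using F(2) W y s by blast
        moreover have "cell W \<subseteq> {0..1}" by (auto simp: cell_def)
        ultimately show ?thesis using d(2) y s by (meson less_imp_le subsetD)
      qed
    qed (use B iter_in[OF x] e(1) in simp_all)
    then show "\<forall>\<^sub>F N in sequentially. dist (avg f (orbit 1 x) N) (\<integral>y. f y \<partial>\<mu>) < r"
      by eventually_elim (use e(2) in \<open>simp add: dist_real_def\<close>)
  qed
  then show "(\<lambda>N. (\<Sum>n<N. f ((T ^^ n) x)) / real N) \<longlonglongrightarrow> (\<integral>y. f y \<partial>\<mu>)"
    by (simp add: avg_def[abs_def])
qed

section \<open>From equidistribution to frequencies of cells\<close>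

text \<open>Continuous functions above the indicator of \<open>K\<close> converge to it pointwise,
  so one of them has integral close to the measure of \<open>K\<close>, and its averages bound those
  of the indicator.\<close>

lemma equidistributed_closed:
  assumes eq: "equidistributed_orbit T \<mu> x" and K: "closed K" "K \<subseteq> {0..1}" and e: "e > 0"
  shows "\<forall>\<^sub>F N in sequentially. avg (indicator K) (orbit 1 x) N \<le> measure \<mu> K + e"
proof (cases "K = {}")
  \<comment> \<open>The empty set is separate because \<open>infdist\<close> to it is 0 by
    convention, so the approximating functions would be constantly 1.\<close>
  case True
  then show ?thesis using e by (simp add: avg_def)
next
  case False
  define u where "u = (\<lambda>j::nat. \<lambda>y. max 0 (1 - real j * infdist y K))"
  have uc: "continuous_on A (u j)" for j A unfolding u_def by (intro continuous_intros)
  have u01: "0 \<le> u j y" "u j y \<le> 1" for j y using infdist_nonneg[of y K] by (auto simp: u_def)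
  have Ks: "K \<in> sets \<mu>" using K by (simp add: in_sets_\<mu>)
  have um: "u j \<in> borel_measurable \<mu>" for j
    using borel_measurable_continuous_on_restrict[OF uc[of "{0..1}" j]]
      measurable_cong_sets[OF sets_\<mu> refl] by blast
  have "(\<lambda>j. \<integral>y. u j y \<partial>\<mu>) \<longlonglongrightarrow> (\<integral>y. indicator K y \<partial>\<mu>)"
  proof (rule integral_dominated_convergence[where w = "\<lambda>_. 1"])
    show "AE y in \<mu>. (\<lambda>j. u j y) \<longlonglongrightarrow> indicator K y"
    proof (rule AE_I2)
      fix y
      show "(\<lambda>j. u j y) \<longlonglongrightarrow> indicator K y"
      proof (cases "y \<in> K")
        case True
        then show ?thesis by (simp add: u_def)
      next
        case False
        then have pos: "infdist y K > 0"
          using in_closed_iff_infdist_zero[OF K(1) \<open>K \<noteq> {}\<close>, of y] infdist_nonneg[of y K] by linarith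
        have "\<forall>\<^sub>F j in sequentially. real j \<ge> 1 / infdist y K"
          by (rule filterlim_real_sequentially[unfolded filterlim_at_top, rule_format])
        then have "\<forall>\<^sub>F j in sequentially. u j y = indicator K y"
          by eventually_elim (use False pos in \<open>simp add: u_def field_simps\<close>)
        then show ?thesis by (rule tendsto_eventually)
      qed
    qed
  qed (use Ks um u01 in auto)
  moreover have "(\<integral>y. indicator K y \<partial>\<mu>) = measure \<mu> K"
    using sets.sets_into_space[OF Ks] Ks by (simp add: Int_absorb2)
  ultimately have "(\<lambda>j. \<integral>y. u j y \<partial>\<mu>) \<longlonglongrightarrow> measure \<mu> K" by simp
  from order_tendstoD(2)[OF this, of "measure \<mu> K + e / 2"] e
  obtain j where j: "(\<integral>y. u j y \<partial>\<mu>) < measure \<mu> K + e / 2" by (auto simp: eventually_sequentially)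
  have "(\<lambda>N. avg (u j) (orbit 1 x) N) \<longlonglongrightarrow> (\<integral>y. u j y \<partial>\<mu>)"
    using eq uc unfolding equidistributed_orbit_def by (simp add: avg_def)
  from order_tendstoD(2)[OF this j]
  show ?thesis
  proof eventually_elim
    case (elim N)
    have "avg (indicator K) (orbit 1 x) N \<le> avg (u j) (orbit 1 x) N"
      by (rule avg_mono) (use u01 in \<open>auto simp: indicator_def u_def\<close>)
    then show ?case using elim e by linarith
  qed
qed

text \<open>A cell is an interval, so its closure and interior differ by a finite null set. The
  closure gives the upper bound for visits, and the closed complement of the interior gives the
  lower one.\<close>

lemma cell_frequency_if_equidistributed:
  assumes eq: "equidistributed_orbit T \<mu> x" and x: "x \<in> {0..1}" and W: "set W \<subseteq> D"
  shows "cell_frequency 1 x W"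
proof -
  let ?J = "cell W" and ?C = "closure (cell W)" and ?O = "interior (cell W)"
  have J01: "?J \<subseteq> {0..1}" by (auto simp: cell_def)
  then have C01: "?C \<subseteq> {0..1}" by (intro closure_minimal) auto
  have "is_interval ?J" unfolding is_interval_1 using cell_ordered[OF W] by blast
  then have "convex ?J" by (simp only: is_interval_convex_1)
  then have "?O = interior ?C" "is_interval ?C"
    by (simp_all add: convex_interior_closure is_interval_convex_1 convex_closure)
  then have "finite (?C - ?O)"
    using finite_interval_minus_interior[of ?C] bdd_below_mono[OF bdd_below_Icc C01]
      bdd_above_mono[OF bdd_above_Icc C01] by simp
  then have null: "?C - ?O \<in> null_sets \<mu>" using C01 by (intro null_finite) auto
  have sets: "?C \<in> sets \<mu>" "?O \<in> sets \<mu>"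
    using C01 J01 interior_subset[of ?J] by (auto simp: in_sets_\<mu>)
  have OJC: "?O \<subseteq> ?J" "?J \<subseteq> ?C" using interior_subset closure_subset by auto
  have "measure \<mu> ?C = measure \<mu> (?O \<union> (?C - ?O))" using OJC by (intro arg_cong[where f = "measure \<mu>"]) blast
  also have "\<dots> = measure \<mu> ?O" by (rule measure_Un_null_set[OF sets(2) null])
  finally have CO: "measure \<mu> ?C = measure \<mu> ?O" .
  have mC: "measure \<mu> ?C = measure \<mu> ?J" and mO: "measure \<mu> ?O = measure \<mu> ?J"
    using finite_measure_mono[OF OJC(1) cell_sets[OF W]] finite_measure_mono[OF OJC(2) sets(1)] CO
    by auto
  have "avg (indicator ?J) (orbit 1 x) \<longlonglongrightarrow> measure \<mu> ?J"
  proof (rule tendstoI)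
    fix e :: real assume e: "e > 0"
    have cl: "closed ({0..1} - ?O)" "{0..1} - ?O \<subseteq> {0..1}" by (auto intro: closed_Diff)
    have mcl: "measure \<mu> ({0..1} - ?O) = 1 - measure \<mu> ?J"
      using prob_compl[OF sets(2)] mO by simp
    have "\<forall>\<^sub>F N in sequentially. avg (indicator ?C) (orbit 1 x) N \<le> measure \<mu> ?C + e / 2"
      by (rule equidistributed_closed[OF eq closed_closure C01]) (use e in simp)
    moreover have "\<forall>\<^sub>F N in sequentially. avg (indicator ({0..1} - ?O)) (orbit 1 x) N
        \<le> measure \<mu> ({0..1} - ?O) + e / 2"
      by (rule equidistributed_closed[OF eq cl]) (use e in simp)
    ultimately show "\<forall>\<^sub>F N in sequentially. dist (avg (indicator ?J) (orbit 1 x) N) (measure \<mu> ?J) < e"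
      using eventually_gt_at_top[of 0]
    proof eventually_elim
      case (elim N)
      have "avg (indicator ?J) (orbit 1 x) N \<le> avg (indicator ?C) (orbit 1 x) N"
        using OJC by (intro avg_mono) (auto simp: indicator_def)
      moreover have "avg (\<lambda>_. 1) (orbit 1 x) N
          \<le> avg (\<lambda>y. indicator ?J y + indicator ({0..1} - ?O) y) (orbit 1 x) N"
        using OJC iter_in[OF x] by (intro avg_mono) (auto simp: indicator_def)
      then have "1 \<le> avg (indicator ?J) (orbit 1 x) N + avg (indicator ({0..1} - ?O)) (orbit 1 x) N"
        using elim(3) by (simp add: avg_const avg_add)
      ultimately show ?case using elim(1,2) mC mcl e unfolding dist_real_def by linarith
    qed
  qed
  then show ?thesis by (simp add: cell_frequency_def)
qed

text \<open>A point is closed and null, so the orbit visits it with frequency 0; an eventually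
  periodic orbit would return to one of its points with frequency at least
  \<open>1 / p\<close>.\<close>

lemma inj_orbit_if_equidistributed:
  assumes eq: "equidistributed_orbit T \<mu> x" and x: "x \<in> {0..1}"
  shows "inj (\<lambda>n. (T ^^ n) x)"
proof (rule ccontr)
  assume "\<not> ?thesis"
  then obtain i p where p: "p > 0" "(T ^^ (i + p)) x = (T ^^ i) x"
    unfolding inj_def by (metis less_imp_add_positive linorder_neqE_nat)
  let ?y = "(T ^^ i) x"
  have y: "?y \<in> {0..1}" by (rule iter_in[OF x])
  then have "{?y} \<in> null_sets \<mu>" by (intro null_finite) auto
  then have m0: "measure \<mu> {?y} = 0" by (rule measure_eq_0_null_sets)
  have "avg (indicator {?y}) (orbit 1 x) \<longlonglongrightarrow> 0"
  proof (rule tendstoI)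
    fix e :: real assume e: "e > 0"
    have "\<forall>\<^sub>F N in sequentially. avg (indicator {?y}) (orbit 1 x) N \<le> measure \<mu> {?y} + e / 2"
      using y e by (intro equidistributed_closed[OF eq]) auto
    then show "\<forall>\<^sub>F N in sequentially. dist (avg (indicator {?y}) (orbit 1 x) N) 0 < e"
    proof eventually_elim
      case (elim N)
      have "0 \<le> avg (indicator {?y}) (orbit 1 x) N" by (simp add: avg_def sum_nonneg)
      then show ?case using elim m0 e by (simp add: dist_real_def)
    qed
  qed
  from avg_eventually_periodic_visit[of p i "orbit 1 x", OF p(1) _ this, of i]
    funpow_eventually_periodic[OF p(2), of 1]
  have "1 / p \<le> (0::real)" by auto
  then show False using p(1) by (simp add: divide_le_0_iff)
qed

section \<open>The equivalences\<close>

text \<open>Separates normality, which counts cylinders, into injectivity of the orbit and a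
  statement on cells; the implications between frequencies are proved for cells.\<close>

lemma normal_iff_cell_frequency:
  assumes x: "x \<in> {0..1}"
  shows "normal_point T \<mu> D I x \<longleftrightarrow>
    inj (\<lambda>n. (T ^^ n) x) \<and> (\<forall>W. set W \<subseteq> D \<longrightarrow> cell_frequency 1 x W)"
proof
  assume n: "normal_point T \<mu> D I x"
  then have cyl: "cyl_frequency 1 x W" if "W \<in> words D k" "k \<ge> 1" for W k
    using that unfolding normal_iff[OF x] by blast
  have inj: "inj (\<lambda>n. (T ^^ n) x)"
  proof (rule inj_orbit_if_cyl_frequency)
    fix K :: nat
    show "\<exists>m>0. \<exists>k\<ge>K. \<forall>W\<in>words D k. cyl_frequency m x W"
      using cyl by (intro exI[of _ 1] conjI exI[of _ "Suc K"]) auto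
  qed
  moreover have "cell_frequency 1 x W" if W: "set W \<subseteq> D" for W
  \<comment> \<open>Normality concerns words of length at least 1; the cell of the empty word is all
    of [0,1].\<close>
  proof (cases "W = []")
    case False
    then have "length W \<ge> 1" by (cases W) auto
    then show ?thesis using cell_frequency_iff_cyl[OF inj x _ W, of 1] cyl[of W "length W"] W
      by (simp add: words_def)
  qed (use cell_frequency_Nil[OF x] in simp)
  ultimately show "inj (\<lambda>n. (T ^^ n) x) \<and> (\<forall>W. set W \<subseteq> D \<longrightarrow> cell_frequency 1 x W)" by blast
next
  assume *: "inj (\<lambda>n. (T ^^ n) x) \<and> (\<forall>W. set W \<subseteq> D \<longrightarrow> cell_frequency 1 x W)"
  then show "normal_point T \<mu> D I x"
    unfolding normal_iff[OF x] using cell_frequency_iff_cyl[of x 1] x by (auto simp: words_def)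
qed

lemma normal_imp_cyl_frequency_power:
  assumes te: "totally_ergodic_map \<mu> T" and x: "x \<in> {0..1}" and n: "normal_point T \<mu> D I x"
    and m: "m > 0" and W: "set W \<subseteq> D"
  shows "cyl_frequency m x W"
proof -
  have inj: "inj (\<lambda>n. (T ^^ n) x)" and freq: "\<And>W. set W \<subseteq> D \<Longrightarrow> cell_frequency 1 x W"
    using n unfolding normal_iff_cell_frequency[OF x] by auto
  show ?thesis
    using cell_frequency_power[OF te x m W freq] cell_frequency_iff_cyl[OF inj x m W] by simp
qed

lemma normal_shift:
  assumes x: "x \<in> {0..1}" and n: "normal_point T \<mu> D I x"
  shows "normal_point T \<mu> D I ((T ^^ k) x)"
proof -
  have inj: "inj (\<lambda>n. (T ^^ n) x)" and freq: "\<And>W. set W \<subseteq> D \<Longrightarrow> cell_frequency 1 x W"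
    using n unfolding normal_iff_cell_frequency[OF x] by auto
  have "inj (\<lambda>n. (T ^^ n) ((T ^^ k) x))"
  proof (rule injI)
    fix a b assume "(T ^^ a) ((T ^^ k) x) = (T ^^ b) ((T ^^ k) x)"
    then have "(T ^^ (a + k)) x = (T ^^ (b + k)) x" by (simp add: funpow_add)
    from injD[OF inj this] show "a = b" by simp
  qed
  then show ?thesis
    unfolding normal_iff_cell_frequency[OF iter_in[OF x]] using cell_frequency_shift[OF freq] by blast
qed

text \<open>Since \<open>m K \<ge> K\<close>, the lengths are unbounded; this first yields
  injectivity, then cells in place of cylinders, and finally all word frequencies.\<close>

lemma normal_if_simply_power_normal:
  fixes m :: "nat \<Rightarrow> nat"
  assumes x: "x \<in> {0..1}" and m: "strict_mono m" "\<And>l. m l \<ge> 1"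
    and simply: "\<And>l. simply_power_normal_point T \<mu> D I (m l) x"
  shows "normal_point T \<mu> D I x"
proof -
  have cyl: "cyl_frequency (m l) x W" if "W \<in> words D (m l)" for l W
    using simply that unfolding simply_power_normal_iff[OF x] by blast
  have inj: "inj (\<lambda>n. (T ^^ n) x)"
  proof (rule inj_orbit_if_cyl_frequency)
    fix K
    show "\<exists>k>0. \<exists>l\<ge>K. \<forall>W\<in>words D l. cyl_frequency k x W"
      using m(2)[of K] strict_mono_imp_increasing[OF m(1), of K] cyl[of _ K]
      by (intro exI[of _ "m K"]) auto
  qed
  moreover have "cell_frequency 1 x W" if W: "set W \<subseteq> D" for W
  proof (rule cell_frequency_if_simply_normal[OF x W])
    fix K
    have "cell_frequency (m K) x V" if "V \<in> words D (m K)" for V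
      using cyl[OF that] cell_frequency_iff_cyl[OF inj x, of "m K" V] m(2)[of K] that
      by (simp add: words_def)
    then show "\<exists>k\<ge>K. \<forall>W\<in>words D k. cell_frequency k x W"
      using strict_mono_imp_increasing[OF m(1), of K] by blast
  qed
  ultimately show ?thesis unfolding normal_iff_cell_frequency[OF x] by blast
qed

lemma normal_iff_equidistributed:
  assumes x: "x \<in> {0..1}"
  shows "normal_point T \<mu> D I x \<longleftrightarrow> equidistributed_orbit T \<mu> x"
  using equidistributed_if_cell_frequency[OF x] cell_frequency_if_equidistributed[OF _ x]
    inj_orbit_if_equidistributed[OF _ x]
  unfolding normal_iff_cell_frequency[OF x] by blast

end

theorem theorem1p14:
  fixes T :: "real \<Rightarrow> real" and \<mu> :: "real measure"
    and D :: "'d set" and I :: "'d \<Rightarrow> real set" and x :: real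
  assumes "F_system T \<mu> D I"
    and "totally_ergodic_map \<mu> T"
    and "x \<in> {0..1}"
  shows "(normal_point T \<mu> D I x \<longleftrightarrow> equidistributed_orbit T \<mu> x) \<and>
    (normal_point T \<mu> D I x \<longleftrightarrow> (\<forall>m\<ge>2. power_normal_point T \<mu> D I m x)) \<and>
    (normal_point T \<mu> D I x \<longleftrightarrow>
      (\<forall>k. \<forall>m\<ge>1. simply_power_normal_point T \<mu> D I m ((T ^^ k) x))) \<and>
    (normal_point T \<mu> D I x \<longleftrightarrow> (\<forall>m\<ge>1. simply_power_normal_point T \<mu> D I m x)) \<and>
    (normal_point T \<mu> D I x \<longleftrightarrow>
      (\<exists>m :: nat \<Rightarrow> nat. strict_mono m \<and> (\<forall>l. m l \<ge> 1) \<and>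
         (\<forall>l. simply_power_normal_point T \<mu> D I (m l) x)))"
    (is "(?i \<longleftrightarrow> ?ii) \<and> (?i \<longleftrightarrow> ?iii) \<and> (?i \<longleftrightarrow> ?iv) \<and> (?i \<longleftrightarrow> ?v) \<and> (?i \<longleftrightarrow> ?vi)")
proof -
  interpret f_system T \<mu> D I by unfold_locales (rule assms(1))
  note x = assms(3)
  have "?i \<longleftrightarrow> ?ii" by (rule normal_iff_equidistributed[OF x])
  \<comment> \<open>Besides the equivalence with (ii), the implications are (i) to (iii) and to
    (iv), (iv) to (v), (v) and (iii) to (vi), and (vi) back to (i).\<close>
  moreover have "?i \<Longrightarrow> ?iii"
    using normal_imp_cyl_frequency_power[OF assms(2) x] unfolding power_normal_iff[OF x] words_def by auto
  moreover have "?i \<Longrightarrow> ?iv"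
    using normal_imp_cyl_frequency_power[OF assms(2) iter_in[OF x] normal_shift[OF x]]
    unfolding simply_power_normal_iff[OF iter_in[OF x]] words_def by auto
  moreover have "?iv \<Longrightarrow> ?v"
    by (metis funpow_0)
  moreover have "?v \<Longrightarrow> ?vi"
    \<comment> \<open>Sequences are indexed from 0, so \<open>Suc\<close> enumerates the positive
      lengths.\<close>
    by (intro exI[of _ Suc]) (simp add: strict_mono_Suc_iff)
  moreover have "?iii \<Longrightarrow> ?vi"
  proof -
    assume iii: ?iii
    \<comment> \<open>The shift by 2 meets the condition \<open>m \<ge> 2\<close>; simple normality
      is the case \<open>p = 1\<close>.\<close>
    have "simply_power_normal_point T \<mu> D I (l + 2) x" for l
    proof -
      have "power_normal_point T \<mu> D I (l + 2) x" using iii by simp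
      then show ?thesis
        unfolding power_normal_iff[OF x] simply_power_normal_iff[OF x]
        by (metis mult_1_right order_refl)
    qed
    then show ?vi by (intro exI[of _ "\<lambda>l. l + 2"]) (simp add: strict_mono_def)
  qed
  moreover have "?vi \<Longrightarrow> ?i"
    using normal_if_simply_power_normal[OF x] by blast
  ultimately show ?thesis by blast
qed

end
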